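(* Let $(X,d,\mu)$ be a $(D,r_0)$-doubling metric measure space that is locally finely $(\alpha,r_0)$-connected with parameters $(C_1,C_2)\in[1,\infty)^2$. Then for any $p>\frac1\alpha$ the space satisfies a local $(1,p)$-Poincaré inequality at scale $r_0/(16C_1)$ with constants $(8C_1,C_{PI})$; in particular $(X,d,\mu)$ is a PI-space. One can take $$M=2(C_2D^4)^{\frac{1}{p\alpha-1}},\qquad \delta=C_2\left(\frac{D^4}{M^p}\right)^{\alpha},\qquad C_{PI}=8D^6\,\frac{C_1M}{1-M\delta}.$$
   Context: Standing assumptions: metric measure spaces $(X,d,\mu)$ are complete and separable, $\mu$ is a Radon measure, and $0<\mu(B(x,r))<\infty$ for all open balls. Here $\alpha>0$, $r_0>0$, $D\geq 1$. $(D,r_0)$-doubling: $\mu(B(x,2r))\le D\,\mu(B(x,r))$ for all $x\in X$, $r\in(0,r_0)$. Connectivity: a curve fragment is a Lipschitz map $\gamma:K\to X$ with $K\subset\mathbb{R}$ compact; it connects $x$ and $y$ if $\gamma(\min K)=x$, $\gamma(\max K)=y$. Writing $[\min K,\max K]\setminus K=\bigcup_i(a_i,b_i)$ with disjoint maximal open intervals, set $\mathrm{gap}(\gamma)=\sum_i d(\gamma(a_i),\gamma(b_i))$; set $\mathrm{len}(\gamma)=\sup\sum_i d(\gamma(t_{i+1}),\gamma(t_i))$ over finite sequences $t_1\le\dots\le t_n$ in $K$. For $C\ge1$, $\eta>0$, $0<\epsilon<1$, a pair $(x,y)$ with $r=d(x,y)>0$ is $(C,\eta,\epsilon)$-connected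 if for every Borel set $E$ with $\mu(E\cap B(x,Cr))<\epsilon\mu(B(x,Cr))$ there is a curve fragment $\gamma:K\to X$ connecting $x$ and $y$ with $\mathrm{len}(\gamma)\le C d(x,y)$, $\mathrm{gap}(\gamma)<\eta d(x,y)$ and $\gamma^{-1}(E)\subset\{\min K,\max K\}$. $X$ is $(C,\eta,\epsilon,r_0)$-connected if every pair with $0<d(x,y)\le r_0$ is $(C,\eta,\epsilon)$-connected. $X$ is locally finely $(\alpha,r_0)$-connected with parameters $(C_1,C_2)$ if for every $0<\tau<1$ it is $(C_1,C_2\tau^\alpha,\tau,r_0)$-connected. Poincaré inequality: with $\mathrm{lip} f(x)=\liminf_{r\to0}\sup_{y\in B(x,r)}|f(x)-f(y)|/r$, $X$ satisfies a local $(1,p)$-Poincaré inequality at scale $r_1>0$ with constants $(C,C_{PI})$ if for all $x\in X$, $r\in(0,r_1)$ and Lipschitz $f:X\to\mathbb{R}$, $$\frac{1}{\mu(B(x,r))}\int_{B(x,r)}|f-f_{B(x,r)}|\,d\mu\le C_{PI}\,r\left(\frac{1}{\mu(B(x,Cr))}\int_{B(x,Cr)}(\mathrm{lip} f)^p\,d\mu\right)^{1/p},$$ where $f_B$ is the average of $f$ over $B$. A complete metric measure space is a PI-space if, for some $p\in[1,\infty)$ and some constants, it is $(D',r_1)$-doubling and satisfies a local $(1,p)$-Poincaré inequality at scale $r_1$. *)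

theory Defs
  imports "HOL-Analysis.Analysis"
begin

definition radon_measure :: "'a::topological_space measure \<Rightarrow> bool" where
  "radon_measure \<mu> \<longleftrightarrow>
     sets \<mu> = sets borel \<and>
     (\<forall>K. compact K \<longrightarrow> emeasure \<mu> K < \<infinity>) \<and>
     (\<forall>B\<in>sets borel. emeasure \<mu> B = (INF U\<in>{U. open U \<and> B \<subseteq> U}. emeasure \<mu> U)) \<and>
     (\<forall>U. open U \<longrightarrow> emeasure \<mu> U = (SUP K\<in>{K. compact K \<and> K \<subseteq> U}. emeasure \<mu> K))"

text \<open>The space \<open>X\<close> is the whole type; completeness and separability are the class
  \<open>polish_space\<close>. Since balls have finite measure, the real-valued \<open>measure\<close> is used on
  subsets of balls below.\<close>

definition metric_measure_space :: "'a::polish_space measure \<Rightarrow> bool" where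
  "metric_measure_space \<mu> \<longleftrightarrow>
     radon_measure \<mu> \<and>
     (\<forall>x r. r > 0 \<longrightarrow> 0 < emeasure \<mu> (ball x r) \<and> emeasure \<mu> (ball x r) < \<infinity>)"

definition doubling :: "'a::metric_space measure \<Rightarrow> real \<Rightarrow> real \<Rightarrow> bool" where
  "doubling \<mu> D r\<^sub>0 \<longleftrightarrow>
     (\<forall>x r. 0 < r \<and> r < r\<^sub>0 \<longrightarrow> measure \<mu> (ball x (2 * r)) \<le> D * measure \<mu> (ball x r))"

text \<open>A curve fragment is a pair of a domain \<open>K\<close> and a total function of which only the values on
  \<open>K\<close> matter. For nonempty compact \<open>K\<close>, \<open>Inf K\<close> and \<open>Sup K\<close> are its minimum and maximum.\<close>

definition curve_fragment :: "real set \<Rightarrow> (real \<Rightarrow> 'a::metric_space) \<Rightarrow> bool" where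
  "curve_fragment K \<gamma> \<longleftrightarrow> compact K \<and> K \<noteq> {} \<and> (\<exists>L. L-lipschitz_on K \<gamma>)"

definition connects :: "real set \<Rightarrow> (real \<Rightarrow> 'a::metric_space) \<Rightarrow> 'a \<Rightarrow> 'a \<Rightarrow> bool" where
  "connects K \<gamma> x y \<longleftrightarrow> \<gamma> (Inf K) = x \<and> \<gamma> (Sup K) = y"

text \<open>The pairs \<open>(a, b)\<close> for which the open interval from \<open>a\<close> to \<open>b\<close> is a maximal one in
  \<open>[min K, max K] - K\<close>; both end points then lie in \<open>K\<close>.\<close>

definition gap_intervals :: "real set \<Rightarrow> (real \<times> real) set" where
  "gap_intervals K =
     {(a, b). a < b \<and> {a<..<b} \<subseteq> {Inf K..Sup K} - K \<and>
        (\<forall>a' b'. {a<..<b} \<subseteq> {a'<..<b'} \<and> {a'<..<b'} \<subseteq> {Inf K..Sup K} - K \<longrightarrow>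
           a' = a \<and> b' = b)}"

definition fragment_gap :: "real set \<Rightarrow> (real \<Rightarrow> 'a::metric_space) \<Rightarrow> ennreal" where
  "fragment_gap K \<gamma> = (\<Sum>\<^sub>\<infinity>(a, b)\<in>gap_intervals K. ennreal (dist (\<gamma> a) (\<gamma> b)))"

definition fragment_len :: "real set \<Rightarrow> (real \<Rightarrow> 'a::metric_space) \<Rightarrow> ennreal" where
  "fragment_len K \<gamma> =
     (SUP ts\<in>{ts. sorted ts \<and> set ts \<subseteq> K}.
        \<Sum>i<length ts - 1. ennreal (dist (\<gamma> (ts ! Suc i)) (\<gamma> (ts ! i))))"

definition connected_pair ::
    "'a::metric_space measure \<Rightarrow> real \<Rightarrow> real \<Rightarrow> real \<Rightarrow> 'a \<Rightarrow> 'a \<Rightarrow> bool" where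
  "connected_pair \<mu> C \<eta> \<epsilon> x y \<longleftrightarrow>
     (\<forall>E\<in>sets borel.
        measure \<mu> (E \<inter> ball x (C * dist x y)) < \<epsilon> * measure \<mu> (ball x (C * dist x y)) \<longrightarrow>
        (\<exists>K \<gamma>. curve_fragment K \<gamma> \<and> connects K \<gamma> x y \<and>
           fragment_len K \<gamma> \<le> ennreal (C * dist x y) \<and>
           fragment_gap K \<gamma> < ennreal (\<eta> * dist x y) \<and>
           {t\<in>K. \<gamma> t \<in> E} \<subseteq> {Inf K, Sup K}))"

definition connected_space ::
    "'a::metric_space measure \<Rightarrow> real \<Rightarrow> real \<Rightarrow> real \<Rightarrow> real \<Rightarrow> bool" where
  "connected_space \<mu> C \<eta> \<epsilon> r\<^sub>0 \<longleftrightarrow>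
     (\<forall>x y. 0 < dist x y \<and> dist x y \<le> r\<^sub>0 \<longrightarrow> connected_pair \<mu> C \<eta> \<epsilon> x y)"

definition locally_finely_connected ::
    "'a::metric_space measure \<Rightarrow> real \<Rightarrow> real \<Rightarrow> real \<Rightarrow> real \<Rightarrow> bool" where
  "locally_finely_connected \<mu> \<alpha> r\<^sub>0 C\<^sub>1 C\<^sub>2 \<longleftrightarrow>
     (\<forall>\<tau>. 0 < \<tau> \<and> \<tau> < 1 \<longrightarrow> connected_space \<mu> C\<^sub>1 (C\<^sub>2 * \<tau> powr \<alpha>) \<tau> r\<^sub>0)"

text \<open>The limit inferior is taken in the extended reals. It is finite for Lipschitz \<open>f\<close>,
  the only case in which \<open>lower_lip\<close> is used.\<close>

definition lower_lip :: "('a::metric_space \<Rightarrow> real) \<Rightarrow> 'a \<Rightarrow> real" where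
  "lower_lip f x =
     real_of_ereal (Liminf (at_right 0) (\<lambda>r. SUP y\<in>ball x r. ereal (\<bar>f x - f y\<bar> / r)))"

definition average :: "'a measure \<Rightarrow> 'a set \<Rightarrow> ('a \<Rightarrow> real) \<Rightarrow> real" where
  "average \<mu> B f = (LINT x:B|\<mu>. f x) / measure \<mu> B"

definition local_poincare ::
    "'a::metric_space measure \<Rightarrow> real \<Rightarrow> real \<Rightarrow> real \<Rightarrow> real \<Rightarrow> bool" where
  "local_poincare \<mu> p r\<^sub>1 C C_PI \<longleftrightarrow>
     (\<forall>x r f. 0 < r \<and> r < r\<^sub>1 \<and> (\<exists>L. L-lipschitz_on UNIV f) \<longrightarrow>
        average \<mu> (ball x r) (\<lambda>z. \<bar>f z - average \<mu> (ball x r) f\<bar>)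
          \<le> C_PI * r * (average \<mu> (ball x (C * r)) (\<lambda>z. lower_lip f z powr p)) powr (1 / p))"

definition PI_space :: "'a::polish_space measure \<Rightarrow> bool" where
  "PI_space \<mu> \<longleftrightarrow>
     metric_measure_space \<mu> \<and>
     (\<exists>p D r\<^sub>1 C C_PI. p \<ge> 1 \<and> D \<ge> 1 \<and> r\<^sub>1 > 0 \<and> C \<ge> 1 \<and> C_PI > 0 \<and>
        doubling \<mu> D r\<^sub>1 \<and> local_poincare \<mu> p r\<^sub>1 C C_PI)"

end

theory Submission
  imports Defs
begin

text \<open>
  Write \<open>g\<close> for the pointwise lower Lipschitz constant of an \<open>L\<close>-Lipschitz function \<open>f\<close>. The heart
  of the proof is a pointwise estimate (\<open>increment_le_if_no_excess\<close>): if the average of \<open>g\<^sup>p\<close> over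
  the ball \<open>B(u, 2 C\<^sub>1 d(u,v))\<close> is at most \<open>\<kappa>\<^sup>p\<close>, then \<open>f\<close> changes by at most
  \<open>\<kappa> d(u,v) C\<^sub>1 M / (1 - M \<delta>)\<close> between \<open>u\<close> and \<open>v\<close>.

  The maximal function of \<open>g\<^sup>p\<close> exceeds \<open>(M \<kappa>)\<^sup>p\<close> on a set which, by a weak type estimate
  (\<open>measure_excess_set_le\<close>), fills less than the fraction \<open>D\<^sup>4 / M\<^sup>p\<close> of \<open>B(u, C\<^sub>1 d(u,v))\<close>. Fine
  connectivity thus yields a fragment from \<open>u\<close> to \<open>v\<close> which avoids this set except at its
  ends, is at most \<open>C\<^sub>1 d(u,v)\<close> long, and has gaps of total size less than \<open>\<delta> d(u,v)\<close>. On the fragment \<open>g\<close> is at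
  most \<open>M \<kappa>\<close>, so \<open>f\<close> changes by at most \<open>M \<kappa> C\<^sub>1 d(u,v)\<close> plus its changes over the gaps
  (\<open>lipschitz_increment_along_fragment\<close>). Every gap has an end point off the exceptional set, so
  the situation repeats there with \<open>M \<kappa>\<close> for \<open>\<kappa>\<close>, and each gap is filled by a further
  fragment. Each generation multiplies the bound on \<open>g\<close> by \<open>M\<close> and the total gap by \<open>\<delta>\<close>. The
  contributions form a geometric series of ratio \<open>M \<delta>\<close>, and what is unfilled after \<open>n\<close>
  generations changes \<open>f\<close> by at most \<open>\<delta>\<^sup>n L d(u,v)\<close>. The condition \<open>p > 1 / \<alpha>\<close> is what makes
  \<open>M \<delta> < 1\<close> possible: \<open>\<delta>\<close> decays like \<open>M\<close> to the power \<open>- p \<alpha>\<close>.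

  Fragments may be null sets, so the bound on \<open>g\<close> must hold at every point off the exceptional set.
  To this end \<open>g\<^sup>p\<close> is replaced by a slightly larger lower semicontinuous function, whose small-ball
  averages dominate it everywhere; only the measure \<open>\<nu>\<close> with this density enters
  (\<open>lower_semicontinuous_majorant_measure\<close>).

  For \<open>u\<close>, \<open>v\<close> in \<open>B(x\<^sub>0, r)\<close> at distance comparable to \<open>r\<close>, the ball \<open>B(u, 2 C\<^sub>1 d(u,v))\<close> carries
  a fixed fraction of the measure of \<open>B(x\<^sub>0, 8 C\<^sub>1 r)\<close>, so the pointwise estimate applies with the
  average over the large ball. Points closer together are compared through a third one
  (\<open>oscillation_le\<close>). If \<open>B(x\<^sub>0, r)\<close> has no point at distance at least \<open>r / 4\<close> from \<open>x\<^sub>0\<close>, then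
  connectivity prevents \<open>B(x\<^sub>0, 8 C\<^sub>1 r)\<close> from having one, and \<open>r\<close> can be lowered until there is
  one, unless the ball is a single point. So \<open>f\<close> deviates from \<open>f x\<^sub>0\<close> by at most the required bound at each point of the ball.

  The argument needs \<open>\<alpha> \<le> 1\<close> and \<open>D > 1\<close>. Both hold as soon as two distinct points are closer than
  \<open>r\<^sub>0\<close>: for \<open>\<alpha> > 1\<close>, removing one of \<open>N\<close> annuli around a point forces a gap of relative size
  \<open>1 / N\<close>, which exceeds \<open>C\<^sub>2 (2 / N)\<^bsup>\<alpha>\<^esup>\<close> for large \<open>N\<close>
  (\<open>no_close_points_if_exponent_gt_1\<close>). Otherwise balls of radius up to \<open>r\<^sub>0\<close> are single points and
  both sides of the inequality vanish.
\<close>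

section \<open>The lower Lipschitz constant\<close>

text \<open>
  For Lipschitz \<open>f\<close> the limit inferior is finite, so the conversion to a real number is harmless.
\<close>
lemma lower_lip_ereal:
  fixes f :: "'a::metric_space \<Rightarrow> real"
  assumes f: "L-lipschitz_on UNIV f"
  defines "S \<equiv> \<lambda>x r. SUP y\<in>ball x r. ereal (\<bar>f x - f y\<bar> / r)"
  shows "ereal (lower_lip f x) = Liminf (at_right 0) (S x)"
    and "0 \<le> lower_lip f x" and "lower_lip f x \<le> L"
proof -
  have pos: "\<forall>\<^sub>F r in at_right (0::real). 0 < r" by (simp add: eventually_at_right_less)
  have "ereal 0 \<le> Liminf (at_right 0) (S x)"
  proof (rule Liminf_bounded, rule eventually_mono[OF pos])
    fix r :: real assume "0 < r"
    then have "ereal (\<bar>f x - f x\<bar> / r) \<le> S x r" unfolding S_def by (intro SUP_upper) auto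
    then show "ereal 0 \<le> S x r" by simp
  qed
  moreover have "Liminf (at_right 0) (S x) \<le> ereal L"
  proof -
    have "Limsup (at_right 0) (S x) \<le> ereal L"
    proof (rule Limsup_bounded, rule eventually_mono[OF pos])
      fix r :: real assume r: "0 < r"
      show "S x r \<le> ereal L" unfolding S_def
      proof (rule SUP_least)
        fix y assume "y \<in> ball x r"
        then have "L * dist x y \<le> L * r"
          using lipschitz_on_nonneg[OF f] by (intro mult_left_mono) auto
        moreover have "\<bar>f x - f y\<bar> \<le> L * dist x y"
          using lipschitz_onD[OF f] by (simp add: dist_real_def)
        ultimately show "ereal (\<bar>f x - f y\<bar> / r) \<le> ereal L"
          using r by (simp add: divide_simps mult.commute)
      qed
    qed
    moreover have "Liminf (at_right 0) (S x) \<le> Limsup (at_right 0) (S x)"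
      by (rule Liminf_le_Limsup) simp
    ultimately show ?thesis by (rule order_trans[rotated])
  qed
  ultimately show eq: "ereal (lower_lip f x) = Liminf (at_right 0) (S x)"
    and "0 \<le> lower_lip f x" and "lower_lip f x \<le> L"
    unfolding lower_lip_def S_def
    by (cases "Liminf (at_right 0) (\<lambda>r. SUP y\<in>ball x r. ereal (\<bar>f x - f y\<bar> / r))"; simp)+
qed

text \<open>
  A bound on a limit inferior speaks about arbitrarily small scales only: there need be no control of
\<open>f\<close> on the balls of intermediate radius.
\<close>
lemma lower_lip_le_iff:
  fixes f :: "'a::metric_space \<Rightarrow> real"
  assumes f: "L-lipschitz_on UNIV f"
  shows "lower_lip f x \<le> a \<longleftrightarrow>
     (\<forall>\<Lambda>>a. \<forall>\<epsilon>>0. \<exists>r. 0 < r \<and> r < \<epsilon> \<and> (\<forall>y\<in>ball x r. \<bar>f x - f y\<bar> \<le> \<Lambda> * r))"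
    (is "_ \<longleftrightarrow> ?R")
proof
  let ?S = "\<lambda>r. SUP y\<in>ball x r. ereal (\<bar>f x - f y\<bar> / r)"
  note eq = lower_lip_ereal(1)[OF f, of x]
  show ?R if le: "lower_lip f x \<le> a"
  proof (intro allI impI, rule ccontr)
    fix \<Lambda> \<epsilon> :: real
    assume "a < \<Lambda>" "0 < \<epsilon>" and
      neg: "\<nexists>r. 0 < r \<and> r < \<epsilon> \<and> (\<forall>y\<in>ball x r. \<bar>f x - f y\<bar> \<le> \<Lambda> * r)"
    have "\<forall>\<^sub>F r in at_right 0. r \<in> {0<..<\<epsilon>}"
      using \<open>0 < \<epsilon>\<close> by (rule eventually_at_right_real)
    then have "ereal \<Lambda> \<le> Liminf (at_right 0) ?S"
    proof (intro Liminf_bounded, elim eventually_mono)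
      fix r assume r: "r \<in> {0<..<\<epsilon>}"
      then obtain y where y: "y \<in> ball x r" "\<Lambda> * r < \<bar>f x - f y\<bar>" using neg by (auto simp: not_le)
      then have "ereal \<Lambda> \<le> ereal (\<bar>f x - f y\<bar> / r)" using r by (simp add: field_simps)
      also have "\<dots> \<le> ?S r" using y by (intro SUP_upper) auto
      finally show "ereal \<Lambda> \<le> ?S r" .
    qed
    then have "\<Lambda> \<le> lower_lip f x" using eq by (metis ereal_less_eq(3))
    then show False using le \<open>a < \<Lambda>\<close> by simp
  qed
  show "lower_lip f x \<le> a" if R: ?R
  proof (rule dense_ge)
    fix \<Lambda> assume "a < \<Lambda>"
    show "lower_lip f x \<le> \<Lambda>"
    proof (rule ccontr)
      assume "\<not> ?thesis"
      then have "ereal \<Lambda> < Liminf (at_right 0) ?S" using eq by (metis less_ereal.simps(1) not_le)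
      then have "\<forall>\<^sub>F r in at_right 0. ereal \<Lambda> < ?S r" by (rule less_LiminfD)
      then obtain b where b: "b > 0" "\<And>r. 0 < r \<Longrightarrow> r < b \<Longrightarrow> ereal \<Lambda> < ?S r"
        by (auto simp: eventually_at_right_field)
      obtain r where r: "0 < r" "r < b" "\<And>y. y \<in> ball x r \<Longrightarrow> \<bar>f x - f y\<bar> \<le> \<Lambda> * r"
        using R \<open>a < \<Lambda>\<close> b(1) by blast
      have "?S r \<le> ereal \<Lambda>"
        by (rule SUP_least) (use r in \<open>auto simp: divide_simps\<close>)
      then show False using b(2)[OF r(1,2)] by (simp add: not_le)
    qed
  qed
qed

text \<open>
  The oscillation of \<open>f\<close> on the open ball of radius \<open>r\<close> increases with \<open>r\<close>, so a good real scale
can be replaced by a slightly smaller rational one at a small cost in the constant. This is the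
countability that measurability rests on.
\<close>
lemma lower_lip_scale_rational:
  fixes f :: "'a::metric_space \<Rightarrow> real"
  assumes f: "L-lipschitz_on UNIV f"
  shows "lower_lip f x \<le> a \<longleftrightarrow>
     (\<forall>k::nat. \<forall>n::nat. \<exists>q\<in>{q\<in>\<rat>. 0 < q \<and> q < 1 / Suc n}.
        \<forall>y\<in>ball x q. \<bar>f x - f y\<bar> \<le> (a + 1 / Suc k) * q)" (is "_ \<longleftrightarrow> ?R")
proof
  assume R: ?R
  show "lower_lip f x \<le> a"
    unfolding lower_lip_le_iff[OF f]
  proof (intro allI impI)
    fix \<Lambda> \<epsilon> :: real assume "a < \<Lambda>" "0 < \<epsilon>"
    obtain k where k: "1 / Suc k < \<Lambda> - a"
      using reals_Archimedean[of "\<Lambda> - a"] \<open>a < \<Lambda>\<close> by (auto simp: inverse_eq_divide)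
    obtain n where n: "1 / Suc n < \<epsilon>"
      using reals_Archimedean[OF \<open>0 < \<epsilon>\<close>] by (auto simp: inverse_eq_divide)
    obtain q where q: "0 < q" "q < 1 / Suc n" "\<forall>y\<in>ball x q. \<bar>f x - f y\<bar> \<le> (a + 1 / Suc k) * q"
      using R[rule_format, of n k] by blast
    have "(a + 1 / Suc k) * q \<le> \<Lambda> * q" using k q by (intro mult_right_mono) auto
    then have "\<forall>y\<in>ball x q. \<bar>f x - f y\<bar> \<le> \<Lambda> * q" using q(3) order_trans by blast
    moreover have "q < \<epsilon>" using q n by linarith
    ultimately show "\<exists>r. 0 < r \<and> r < \<epsilon> \<and> (\<forall>y\<in>ball x r. \<bar>f x - f y\<bar> \<le> \<Lambda> * r)"
      using q(1) by blast
  qed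
next
  assume le: "lower_lip f x \<le> a"
  then have "0 \<le> a" using lower_lip_ereal(2)[OF f, of x] by simp
  show ?R
  proof (intro allI)
    fix k n :: nat
    define \<Lambda> where "\<Lambda> = a + 1 / (2 * Suc k)"
    have "a < \<Lambda>" by (simp add: \<Lambda>_def)
    moreover have "0 < 1 / real (Suc n)" by simp
    ultimately obtain r where r: "0 < r" "r < 1 / Suc n" "\<And>y. y\<in>ball x r \<Longrightarrow> \<bar>f x - f y\<bar> \<le> \<Lambda> * r"
      using le unfolding lower_lip_le_iff[OF f] by blast
    define c where "c = a + 1 / Suc k"
    have "\<Lambda> < c" by (simp add: c_def \<Lambda>_def field_simps)
    then have c: "\<Lambda> < c" "0 < c" using \<open>0 \<le> a\<close> \<open>a < \<Lambda>\<close> by auto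
    then have "\<Lambda> * r / c < r" using r by (simp add: field_simps)
    then obtain q where q: "q \<in> \<rat>" "\<Lambda> * r / c < q" "q < r" using Rats_dense_in_real by blast
    have "0 \<le> \<Lambda> * r / c" using r c \<open>a < \<Lambda>\<close> \<open>0 \<le> a\<close> by simp
    then have "0 < q" using q by simp
    have "\<Lambda> * r \<le> c * q" using q c by (simp add: field_simps)
    then have "\<bar>f x - f y\<bar> \<le> c * q" if "y \<in> ball x q" for y
      using r(3)[of y] q(3) that by simp
    then show "\<exists>q\<in>{q\<in>\<rat>. 0 < q \<and> q < 1 / Suc n}. \<forall>y\<in>ball x q. \<bar>f x - f y\<bar> \<le> (a + 1 / Suc k) * q"
      using q(1,3) r(2) \<open>0 < q\<close> unfolding c_def by (intro bexI[of _ q]) auto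
  qed
qed

lemma closed_oscillation_le:
  fixes f :: "'a::metric_space \<Rightarrow> real"
  assumes "continuous_on UNIV f"
  shows "closed {x. \<forall>y\<in>ball x r. \<bar>f x - f y\<bar> \<le> c}"
proof -
  have "{x. \<forall>y\<in>ball x r. \<bar>f x - f y\<bar> \<le> c} =
      (\<Inter>y. {x. r \<le> dist x y} \<union> {x. \<bar>f x - f y\<bar> \<le> c})"
    by (auto simp: not_le not_less) (meson not_le)
  also have "closed \<dots>"
    by (intro closed_INT ballI closed_Un closed_Collect_le continuous_intros assms)
  finally show ?thesis .
qed

lemma borel_measurable_lower_lip:
  fixes f :: "'a::metric_space \<Rightarrow> real"
  assumes f: "L-lipschitz_on UNIV f"
  shows "lower_lip f \<in> borel_measurable borel"
  unfolding borel_measurable_iff_le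
proof
  fix a
  let ?Q = "\<lambda>n. {q\<in>\<rat>. 0 < q \<and> q < 1 / real (Suc n)}"
  have "{x. lower_lip f x \<le> a} =
      (\<Inter>k. \<Inter>n. \<Union>q\<in>?Q n. {x. \<forall>y\<in>ball x q. \<bar>f x - f y\<bar> \<le> (a + 1 / Suc k) * q})"
    unfolding lower_lip_scale_rational[OF f] by auto
  also have "\<dots> \<in> sets borel"
  proof (intro sets.countable_INT'' sets.countable_UN' subsetI)
    show "countable (?Q n)" for n by (rule countable_subset[OF _ countable_rat]) auto
  qed (auto intro!: borel_closed closed_oscillation_le lipschitz_on_continuous_on[OF f])
  finally show "{w \<in> space borel. lower_lip f w \<le> a} \<in> sets borel" by simp
qed

section \<open>Gaps and lengths of curve fragments\<close>

lemma consecutive_points_gap_interval: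
  assumes "compact K" "a \<in> K" "b \<in> K" "a < b" "K \<inter> {a<..<b} = {}"
  shows "(a, b) \<in> gap_intervals K"
proof -
  have bb: "bdd_below K" "bdd_above K"
    using assms(1) by (auto simp: bounded_imp_bdd_above bounded_imp_bdd_below compact_imp_bounded)
  have "Inf K \<le> a" "b \<le> Sup K"
    using bb assms(2,3) by (auto intro: cInf_lower cSup_upper)
  then have sub: "{a<..<b} \<subseteq> {Inf K..Sup K} - K" using assms(5) by auto
  have "a' = a \<and> b' = b"
    if h: "{a<..<b} \<subseteq> {a'<..<b'}" "{a'<..<b'} \<subseteq> {Inf K..Sup K} - K" for a' b'
  proof -
    have "a' \<le> a \<and> b \<le> b'" using h(1) assms(4) by (simp add: greaterThanLessThan_subseteq_greaterThanLessThan)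
    moreover have "a \<notin> {a'<..<b'}" "b \<notin> {a'<..<b'}" using h(2) assms(2,3) by auto
    ultimately show ?thesis using assms(4) by auto
  qed
  then show ?thesis using sub assms(4) by (auto simp: gap_intervals_def)
qed

text \<open>
  An end point outside the compact set \<open>K\<close> would leave room to enlarge the interval.
\<close>
lemma gap_interval_endpoints:
  assumes "compact K" "K \<noteq> {}" "(a, b) \<in> gap_intervals K"
  shows "a \<in> K" "b \<in> K" "a < b"
proof -
  have sub: "{a<..<b} \<subseteq> {Inf K..Sup K} - K" and ab: "a < b"
    and mx: "\<And>a' b'. {a<..<b} \<subseteq> {a'<..<b'} \<Longrightarrow> {a'<..<b'} \<subseteq> {Inf K..Sup K} - K \<Longrightarrow> a' = a \<and> b' = b"
    using assms(3) by (auto simp: gap_intervals_def)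
  have bb: "bdd_below K" "bdd_above K"
    using assms(1) by (auto simp: bounded_imp_bdd_above bounded_imp_bdd_below compact_imp_bounded)
  have ends: "Inf K \<in> K" "Sup K \<in> K"
    using assms(1,2) bb by (auto intro: closed_contains_Inf closed_contains_Sup compact_imp_closed)
  show "a < b" by fact
  have "{a<..<b} \<subseteq> {Inf K..Sup K}" using sub by blast
  then have "closure {a<..<b} \<subseteq> {Inf K..Sup K}" by (rule closure_minimal) simp
  then have cl: "{a..b} \<subseteq> {Inf K..Sup K}" using ab by simp
  have op: "open (- K)" using assms(1) by (simp add: compact_imp_closed open_Compl)
  show "a \<in> K"
  proof (rule ccontr)
    assume "a \<notin> K"
    then obtain e where e: "e > 0" "ball a e \<subseteq> - K" using op open_contains_ball by blast
    have "a \<noteq> Inf K" using \<open>a \<notin> K\<close> ends by auto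
    then have "Inf K < a" using cl ab by auto
    define a' where "a' = max (Inf K) (a - e)"
    have lt: "a' < a" using \<open>Inf K < a\<close> e by (simp add: a'_def)
    have "x \<in> {Inf K..Sup K} - K" if "x \<in> {a'<..<b}" for x
    proof (cases "x > a")
      case True then show ?thesis using that sub by auto
    next
      case False
      then have "x \<in> ball a e" using that by (auto simp: a'_def dist_real_def)
      moreover have "Inf K \<le> x" "x \<le> Sup K" using that False cl ab by (auto simp: a'_def)
      ultimately show ?thesis using e by auto
    qed
    then have "{a'<..<b} \<subseteq> {Inf K..Sup K} - K" by blast
    moreover have "{a<..<b} \<subseteq> {a'<..<b}" using lt by auto
    ultimately have "a' = a" using mx by blast
    then show False using lt by simp
  qed
  show "b \<in> K"
  proof (rule ccontr)
    assume "b \<notin> K"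
    then obtain e where e: "e > 0" "ball b e \<subseteq> - K" using op open_contains_ball by blast
    have "b \<noteq> Sup K" using \<open>b \<notin> K\<close> ends by auto
    then have "b < Sup K" using cl ab by auto
    define b' where "b' = min (Sup K) (b + e)"
    have lt: "b < b'" using \<open>b < Sup K\<close> e by (simp add: b'_def)
    have "x \<in> {Inf K..Sup K} - K" if "x \<in> {a<..<b'}" for x
    proof (cases "x < b")
      case True then show ?thesis using that sub by auto
    next
      case False
      then have "x \<in> ball b e" using that by (auto simp: b'_def dist_real_def)
      moreover have "Inf K \<le> x" "x \<le> Sup K" using that False cl ab by (auto simp: b'_def)
      ultimately show ?thesis using e by auto
    qed
    then have "{a<..<b'} \<subseteq> {Inf K..Sup K} - K" by blast
    moreover have "{a<..<b} \<subseteq> {a<..<b'}" using lt by auto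
    ultimately have "b' = b" using mx by blast
    then show False using lt by simp
  qed
qed

text \<open>
  The gap runs from the last point of \<open>K\<close> with \<open>\<phi> \<le> u\<close> to the first later one with
\<open>v \<le> \<phi>\<close>.
\<close>
lemma jump_across_forbidden_values:
  fixes \<phi> :: "real \<Rightarrow> real"
  assumes K: "compact K" "K \<noteq> {}" and cont: "continuous_on K \<phi>"
    and ends: "\<phi> (Inf K) \<le> u" "v \<le> \<phi> (Sup K)" and "u < v"
    and avoid: "\<And>t. t \<in> K \<Longrightarrow> \<not> (u < \<phi> t \<and> \<phi> t < v)"
  obtains a b where "(a, b) \<in> gap_intervals K" "\<phi> a \<le> u" "v \<le> \<phi> b"
proof -
  have bb: "bdd_below K" "bdd_above K"
    using K by (auto simp: bounded_imp_bdd_above bounded_imp_bdd_below compact_imp_bounded)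
  have inK: "Inf K \<in> K" "Sup K \<in> K"
    using K bb by (auto intro: closed_contains_Inf closed_contains_Sup compact_imp_closed)
  define T where "T = K \<inter> \<phi> -` {..u}"
  have "closed T" unfolding T_def
    by (rule continuous_closed_preimage[OF cont]) (use K in \<open>auto simp: compact_imp_closed\<close>)
  moreover have "Inf K \<in> T" using inK ends by (simp add: T_def)
  moreover have bT: "bdd_above T" using bb by (auto simp: T_def)
  ultimately have aT: "Sup T \<in> T" by (intro closed_contains_Sup) auto
  define a where "a = Sup T"
  have a: "a \<in> K" "\<phi> a \<le> u" using aT by (auto simp: T_def a_def)
  define U where "U = (K \<inter> {a..}) \<inter> \<phi> -` {v..}"
  have "closed U" unfolding U_def
    by (rule continuous_closed_preimage)
       (use K in \<open>auto simp: compact_imp_closed intro: continuous_on_subset[OF cont]\<close>)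
  moreover have "Sup K \<in> U" using inK ends a bb by (auto simp: U_def cSup_upper)
  moreover have "bdd_below U" using bb by (auto simp: U_def)
  ultimately have bU: "Inf U \<in> U" by (intro closed_contains_Inf) auto
  define b where "b = Inf U"
  have b: "b \<in> K" "a \<le> b" "v \<le> \<phi> b" using bU by (auto simp: U_def b_def)
  have "a \<noteq> b" using a b \<open>u < v\<close> by auto
  then have "a < b" using b by simp
  have "t \<notin> K" if "t \<in> {a<..<b}" for t
  proof
    assume "t \<in> K"
    have "t \<notin> T" using that bT cSup_upper[of t T] by (auto simp: a_def)
    then have "u < \<phi> t" using \<open>t \<in> K\<close> by (auto simp: T_def)
    then have "t \<in> U" using avoid[OF \<open>t \<in> K\<close>] that \<open>t \<in> K\<close> by (auto simp: U_def)
    then have "b \<le> t" unfolding b_def using \<open>bdd_below U\<close> by (rule cInf_lower)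
    then show False using that by auto
  qed
  then have "(a, b) \<in> gap_intervals K"
    using K a b \<open>a < b\<close> by (intro consecutive_points_gap_interval) auto
  then show thesis using that a b by blast
qed

lemma fragment_len_mono: "K \<subseteq> K' \<Longrightarrow> fragment_len K \<gamma> \<le> fragment_len K' \<gamma>"
  unfolding fragment_len_def by (rule SUP_subset_mono) auto

text \<open>
  Length is superadditive. This form lets the length of the part of a fragment up to \<open>t\<close> serve as a
budget that grows by at least the distance travelled.
\<close>
lemma fragment_len_increment:
  assumes "s \<in> K" "t \<in> K" "s \<le> t"
  shows "fragment_len (K \<inter> {..s}) \<gamma> + ennreal (dist (\<gamma> s) (\<gamma> t)) \<le> fragment_len (K \<inter> {..t}) \<gamma>"
proof -
  let ?F = "\<lambda>ts i. ennreal (dist (\<gamma> (ts ! Suc i)) (\<gamma> (ts ! i)))"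
  let ?I = "{ts. sorted ts \<and> set ts \<subseteq> K \<inter> {..s}}"
  have "fragment_len (K \<inter> {..s}) \<gamma> + ennreal (dist (\<gamma> s) (\<gamma> t)) =
        (SUP ts\<in>?I. (\<Sum>i<length ts - 1. ?F ts i) + ennreal (dist (\<gamma> s) (\<gamma> t)))"
    unfolding fragment_len_def by (subst ennreal_SUP_add_left) (auto intro!: exI[of _ "[]"])
  also have "\<dots> \<le> fragment_len (K \<inter> {..t}) \<gamma>"
  proof (rule SUP_least)
    fix ts assume ts: "ts \<in> ?I"
    let ?ts = "ts @ [s, t]" and ?n = "length ts"
    have "(\<Sum>i<?n - 1. ?F ts i) = (\<Sum>i<?n - 1. ?F ?ts i)"
      by (intro sum.cong) (auto simp: nth_append)
    also have "\<dots> \<le> (\<Sum>i<?n. ?F ?ts i)" by (intro sum_mono2) auto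
    finally have "(\<Sum>i<?n - 1. ?F ts i) + ennreal (dist (\<gamma> s) (\<gamma> t)) \<le>
        (\<Sum>i<?n. ?F ?ts i) + ennreal (dist (\<gamma> s) (\<gamma> t))"
      by (intro add_right_mono)
    also have "\<dots> = (\<Sum>i<length ?ts - 1. ?F ?ts i)"
      by (simp add: nth_append dist_commute)
    also have "\<dots> \<le> fragment_len (K \<inter> {..t}) \<gamma>"
      unfolding fragment_len_def
    proof (rule SUP_upper)
      show "?ts \<in> {ts. sorted ts \<and> set ts \<subseteq> K \<inter> {..t}}"
        using ts assms by (fastforce simp: sorted_append)
    qed
    finally show "(\<Sum>i<?n - 1. ?F ts i) + ennreal (dist (\<gamma> s) (\<gamma> t))
       \<le> fragment_len (K \<inter> {..t}) \<gamma>" .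
  qed
  finally show ?thesis .
qed

lemma dist_le_fragment_len:
  assumes "s \<in> K" "t \<in> K" "s \<le> t"
  shows "ennreal (dist (\<gamma> s) (\<gamma> t)) \<le> fragment_len K \<gamma>"
proof -
  have "ennreal (dist (\<gamma> s) (\<gamma> t)) \<le> fragment_len (K \<inter> {..s}) \<gamma> + ennreal (dist (\<gamma> s) (\<gamma> t))"
    by simp
  also have "\<dots> \<le> fragment_len (K \<inter> {..t}) \<gamma>" by (rule fragment_len_increment[OF assms])
  also have "\<dots> \<le> fragment_len K \<gamma>" by (rule fragment_len_mono) auto
  finally show ?thesis .
qed

definition gap_upto :: "real set \<Rightarrow> (real \<Rightarrow> 'a::metric_space) \<Rightarrow> real \<Rightarrow> ennreal" where
  "gap_upto K \<gamma> t =
     (\<Sum>\<^sub>\<infinity>(a, b)\<in>{(a, b)\<in>gap_intervals K. b \<le> t}. ennreal (dist (\<gamma> a) (\<gamma> b)))"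

lemma gap_upto_mono: "s \<le> t \<Longrightarrow> gap_upto K \<gamma> s \<le> gap_upto K \<gamma> t"
  unfolding gap_upto_def
  by (rule infsum_mono_neutral) (auto intro!: nonneg_summable_on_complete)

lemma gap_upto_le: "gap_upto K \<gamma> t \<le> fragment_gap K \<gamma>"
  unfolding gap_upto_def fragment_gap_def
  by (rule infsum_mono_neutral) (auto intro!: nonneg_summable_on_complete)

lemma gap_upto_increment:
  assumes "(a, b) \<in> gap_intervals K" "s \<le> a" "a < b"
  shows "gap_upto K \<gamma> s + ennreal (dist (\<gamma> a) (\<gamma> b)) \<le> gap_upto K \<gamma> b"
proof -
  let ?f = "\<lambda>(a, b). ennreal (dist (\<gamma> a) (\<gamma> b))"
  let ?S = "{(a, b)\<in>gap_intervals K. b \<le> s}"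
  have "gap_upto K \<gamma> s + ennreal (dist (\<gamma> a) (\<gamma> b)) = infsum ?f ?S + infsum ?f {(a, b)}"
    by (simp add: gap_upto_def)
  also have "\<dots> = infsum ?f (?S \<union> {(a, b)})"
    using assms by (subst infsum_Un_disjoint) (auto intro!: nonneg_summable_on_complete)
  also have "\<dots> \<le> gap_upto K \<gamma> b"
    unfolding gap_upto_def
    by (rule infsum_mono_neutral) (use assms in \<open>auto intro!: nonneg_summable_on_complete\<close>)
  finally show ?thesis .
qed

lemma dist_le_fragment_gap:
  assumes "(a, b) \<in> gap_intervals K" "a < b"
  shows "ennreal (dist (\<gamma> a) (\<gamma> b)) \<le> fragment_gap K \<gamma>"
proof -
  have "ennreal (dist (\<gamma> a) (\<gamma> b)) \<le> gap_upto K \<gamma> a + ennreal (dist (\<gamma> a) (\<gamma> b))" by simp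
  also have "\<dots> \<le> gap_upto K \<gamma> b" by (rule gap_upto_increment) (use assms in auto)
  also have "\<dots> \<le> fragment_gap K \<gamma>" by (rule gap_upto_le)
  finally show ?thesis .
qed

text \<open>
  A continuity argument along a compact set. The supremum of the points reached within the budget
\<open>W\<close> is itself reached, because \<open>F\<close> is continuous and \<open>W\<close> monotone, and the step hypothesis
carries any reached point other than \<open>Sup K\<close> further to the right.
\<close>
lemma increment_le_by_continuation:
  fixes F W :: "real \<Rightarrow> real"
  assumes K: "compact K" and t\<^sub>0: "t\<^sub>0 \<in> K"
    and F: "continuous_on K F" and W: "mono_on K W"
    and step: "\<And>t. t \<in> K \<Longrightarrow> t\<^sub>0 \<le> t \<Longrightarrow> t < Sup K \<Longrightarrow>
                 \<exists>t'\<in>K. t < t' \<and> \<bar>F t' - F t\<bar> \<le> W t' - W t"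
  shows "\<bar>F (Sup K) - F t\<^sub>0\<bar> \<le> W (Sup K) - W t\<^sub>0"
proof -
  have bb: "bdd_above K" using K by (simp add: bounded_imp_bdd_above compact_imp_bounded)
  define T where "T = {t\<in>K. t\<^sub>0 \<le> t \<and> \<bar>F t - F t\<^sub>0\<bar> \<le> W t - W t\<^sub>0}"
  have TK: "T \<subseteq> K" by (auto simp: T_def)
  have t0T: "t\<^sub>0 \<in> T" using t\<^sub>0 by (simp add: T_def)
  have bT: "bdd_above T" using bb TK by (rule bdd_above_mono)
  define m where "m = Sup T"
  have "m \<in> closure T" unfolding m_def using t0T bT by (intro closure_contains_Sup) auto
  then obtain x where x: "\<And>n. x n \<in> T" "x \<longlonglongrightarrow> m" by (auto simp: closure_sequential)
  have mK: "m \<in> K"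
    using K x TK by (meson closed_sequentially compact_imp_closed subsetD)
  have le: "x n \<le> m" for n unfolding m_def using x(1) bT by (intro cSup_upper) auto
  have "(\<lambda>n. F (x n)) \<longlonglongrightarrow> F m"
    using F x mK TK by (auto simp: continuous_on_sequentially o_def)
  then have lim: "(\<lambda>n. \<bar>F (x n) - F t\<^sub>0\<bar>) \<longlonglongrightarrow> \<bar>F m - F t\<^sub>0\<bar>" by (intro tendsto_intros)
  have "\<bar>F (x n) - F t\<^sub>0\<bar> \<le> W m - W t\<^sub>0" for n
  proof -
    have "W (x n) \<le> W m" using W le x(1) TK mK by (auto intro: mono_onD)
    then show ?thesis using x(1)[of n] by (auto simp: T_def)
  qed
  then have "\<bar>F m - F t\<^sub>0\<bar> \<le> W m - W t\<^sub>0" using lim by (intro LIMSEQ_le_const2) auto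
  moreover have t0m: "t\<^sub>0 \<le> m" unfolding m_def using t0T bT by (rule cSup_upper)
  ultimately have mT: "m \<in> T" using mK by (simp add: T_def)
  have "m = Sup K"
  proof (rule ccontr)
    assume "m \<noteq> Sup K"
    then have "m < Sup K" using cSup_upper[OF mK bb] by simp
    then obtain t' where t': "t' \<in> K" "m < t'" "\<bar>F t' - F m\<bar> \<le> W t' - W m"
      using step mK t0m by blast
    then have "t' \<in> T" using mT t0m by (auto simp: T_def)
    then have "t' \<le> m" unfolding m_def using bT by (rule cSup_upper)
    then show False using t' by simp
  qed
  then show ?thesis using mT by (simp add: T_def)
qed

lemma first_exit:
  fixes \<gamma> :: "real \<Rightarrow> 'a::metric_space"
  assumes K: "compact K" and cont: "continuous_on K \<gamma>" and t: "t \<in> K"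
    and s: "s \<in> K" "t \<le> s" and r: "0 < r" "r \<le> dist (\<gamma> t) (\<gamma> s)"
  obtains t' where "t' \<in> K" "t < t'" "r \<le> dist (\<gamma> t) (\<gamma> t')"
    "\<And>u. u \<in> K \<Longrightarrow> t \<le> u \<Longrightarrow> u < t' \<Longrightarrow> dist (\<gamma> t) (\<gamma> u) < r"
proof -
  define U where "U = (K \<inter> {t..}) \<inter> (\<lambda>u. dist (\<gamma> t) (\<gamma> u)) -` {r..}"
  have bU: "bdd_below U" by (auto simp: U_def)
  have "closed U" unfolding U_def
    by (rule continuous_closed_preimage)
       (use K in \<open>auto simp: compact_imp_closed intro!: continuous_intros continuous_on_subset[OF cont]\<close>)
  moreover have "s \<in> U" using s r by (simp add: U_def)
  ultimately have inU: "Inf U \<in> U" using bU by (intro closed_contains_Inf) auto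
  show thesis
  proof
    show "Inf U \<in> K" "r \<le> dist (\<gamma> t) (\<gamma> (Inf U))" using inU by (auto simp: U_def)
    then have "Inf U \<noteq> t" using r by auto
    then show "t < Inf U" using inU by (auto simp: U_def)
    show "dist (\<gamma> t) (\<gamma> u) < r" if "u \<in> K" "t \<le> u" "u < Inf U" for u
    proof (rule ccontr)
      assume "\<not> ?thesis"
      then have "u \<in> U" using that by (simp add: U_def)
      then have "Inf U \<le> u" using bU by (rule cInf_lower)
      then show False using that by simp
    qed
  qed
qed

lemma left_limit_or_gap:
  fixes K :: "real set"
  assumes K: "compact K" and "t \<in> K" "t' \<in> K" "t < t'"
  obtains (limit) x where "\<And>n. x n \<in> K" "\<And>n. t \<le> x n" "\<And>n. x n < t'" "x \<longlonglongrightarrow> t'"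
    | (gap) u where "u \<in> K" "t \<le> u" "u < t'" "(u, t') \<in> gap_intervals K"
proof -
  define V where "V = K \<inter> {t..<t'}"
  have V: "t \<in> V" "bdd_above V" using assms by (auto simp: V_def)
  have "Sup V \<in> closure V" using V by (intro closure_contains_Sup) auto
  then obtain x where x: "\<And>n. x n \<in> V" "x \<longlonglongrightarrow> Sup V" by (auto simp: closure_sequential)
  have "Sup V \<le> t'" using V by (intro cSup_least) (auto simp: V_def)
  show thesis
  proof (cases "Sup V = t'")
    case True
    then show thesis using x limit[of x] by (auto simp: V_def)
  next
    case False
    then have lt: "Sup V < t'" using \<open>Sup V \<le> t'\<close> by simp
    have inK: "Sup V \<in> K"
      using K x by (metis Int_iff V_def closed_sequentially compact_imp_closed)
    have ge: "t \<le> Sup V" using V by (rule cSup_upper)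
    have "w \<notin> K" if "w \<in> {Sup V<..<t'}" for w
    proof
      assume "w \<in> K"
      then have "w \<in> V" using that ge by (auto simp: V_def)
      then have "w \<le> Sup V" using V(2) by (rule cSup_upper)
      then show False using that by simp
    qed
    then have "(Sup V, t') \<in> gap_intervals K"
      using K inK assms lt by (intro consecutive_points_gap_interval) auto
    then show thesis using gap inK ge lt by blast
  qed
qed

lemma enn2real_add_le:
  assumes "x + ennreal d \<le> y" "y \<le> ennreal c" "0 \<le> d"
  shows "enn2real x + d \<le> enn2real y"
proof -
  have y: "y < top" using assms(2) by (simp add: le_less_trans)
  then have "x < top" using assms(1) by (metis add_increasing2 le_less_trans order_refl zero_le)
  then have "enn2real x + d = enn2real (x + ennreal d)"
    using assms(3) by (simp add: enn2real_plus)
  also have "\<dots> \<le> enn2real y" using assms(1) y by (intro enn2real_mono)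
  finally show ?thesis .
qed

text \<open>
  A substitute for integrating an upper gradient along a fragment, by a first exit argument.
Suppose the oscillation of \<open>f\<close> on the ball of radius \<open>r\<close> around \<open>\<gamma> t\<close> is at most \<open>\<Lambda>' r\<close>. By the
time the fragment leaves this ball, at \<open>t'\<close>, it has spent at least \<open>r\<close> of its length, which pays
for the change of \<open>f\<close> inside the ball. If it leaves by a jump, then the last gap before \<open>t'\<close> pays
for the jump itself. Arbitrarily small scales \<open>r\<close> suffice for this, so a bound on the limit
inferior is enough.
\<close>
lemma lipschitz_increment_along_fragment:
  fixes \<gamma> :: "real \<Rightarrow> 'a::metric_space" and f :: "'a \<Rightarrow> real"
  assumes frag: "curve_fragment K \<gamma>" and f: "L-lipschitz_on UNIV f"
    and len: "fragment_len K \<gamma> \<le> ennreal l" "0 \<le> l"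
    and gap: "fragment_gap K \<gamma> \<le> ennreal g" "0 \<le> g"
    and lip: "\<And>t. t \<in> K \<Longrightarrow> Inf K < t \<Longrightarrow> t < Sup K \<Longrightarrow> lower_lip f (\<gamma> t) \<le> \<Lambda>"
    and jumps: "\<And>a b. (a, b) \<in> gap_intervals K \<Longrightarrow> \<bar>f (\<gamma> b) - f (\<gamma> a)\<bar> \<le> S * dist (\<gamma> a) (\<gamma> b)"
    and "0 \<le> \<Lambda>" "0 \<le> S"
  shows "\<bar>f (\<gamma> (Sup K)) - f (\<gamma> (Inf K))\<bar> \<le> \<Lambda> * l + S * g"
proof -
  have K: "compact K" "K \<noteq> {}" and cont: "continuous_on K \<gamma>"
    using frag by (auto simp: curve_fragment_def intro: lipschitz_on_continuous_on)
  have bb: "bdd_below K" "bdd_above K"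
    using K by (auto simp: bounded_imp_bdd_above bounded_imp_bdd_below compact_imp_bounded)
  have inK: "Inf K \<in> K" "Sup K \<in> K"
    using K bb by (auto intro: closed_contains_Inf closed_contains_Sup compact_imp_closed)
  define F where "F = f \<circ> \<gamma>"
  have contF: "continuous_on K F" unfolding F_def
    by (intro continuous_on_compose cont continuous_on_subset[OF lipschitz_on_continuous_on[OF f]]) auto
  define \<rho> where "\<rho> = (\<lambda>t. enn2real (fragment_len (K \<inter> {..t}) \<gamma>))"
  define \<sigma> where "\<sigma> = (\<lambda>t. enn2real (gap_upto K \<gamma> t))"
  have len_bd: "fragment_len (K \<inter> {..t}) \<gamma> \<le> ennreal l" for t
    by (rule order_trans[OF fragment_len_mono len(1)]) simp
  have gap_bd: "gap_upto K \<gamma> t \<le> ennreal g" for t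
    by (rule order_trans[OF gap_upto_le gap(1)])
  have \<rho>_inc: "\<rho> s + dist (\<gamma> s) (\<gamma> t) \<le> \<rho> t" if "s \<in> K" "t \<in> K" "s \<le> t" for s t
    unfolding \<rho>_def using fragment_len_increment[OF that] len_bd by (rule enn2real_add_le) simp
  have \<sigma>_inc: "\<sigma> s + dist (\<gamma> a) (\<gamma> b) \<le> \<sigma> b" if "(a, b) \<in> gap_intervals K" "s \<le> a" for s a b
    unfolding \<sigma>_def
    using gap_upto_increment[OF that gap_interval_endpoints(3)[OF K that(1)]] gap_bd
    by (rule enn2real_add_le) simp
  have \<sigma>_mono: "\<sigma> s \<le> \<sigma> t" if "s \<le> t" for s t
    unfolding \<sigma>_def using gap_upto_mono[OF that, of K \<gamma>] gap_bd[of t]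
    by (intro enn2real_mono) (auto simp: le_less_trans)
  have main: "\<bar>F (Sup K) - F (Inf K)\<bar> \<le> \<Lambda>' * l + S * g" if "\<Lambda> < \<Lambda>'" for \<Lambda>'
  proof -
    have "0 \<le> \<Lambda>'" using that \<open>0 \<le> \<Lambda>\<close> by simp
    \<comment> \<open>The budget: the length and the gaps used up to \<open>t\<close>.\<close>
    define W where "W = (\<lambda>t. \<Lambda>' * \<rho> t + S * \<sigma> t)"
    have W_mono: "mono_on K W" unfolding W_def
    proof (intro mono_onI add_mono mult_left_mono)
      fix s t assume "s \<in> K" "t \<in> K" "s \<le> t"
      then show "\<rho> s \<le> \<rho> t" using \<rho>_inc[of s t] zero_le_dist[of "\<gamma> s" "\<gamma> t"] by linarith
    qed (use \<sigma>_mono \<open>0 \<le> \<Lambda>'\<close> \<open>0 \<le> S\<close> in auto)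
    have W_end: "W (Sup K) - W t \<le> \<Lambda>' * l + S * g" for t
    proof -
      have "\<rho> (Sup K) \<le> l" "\<sigma> (Sup K) \<le> g" "0 \<le> \<rho> t" "0 \<le> \<sigma> t"
        unfolding \<rho>_def \<sigma>_def using len_bd gap_bd len(2) gap(2) by (auto intro!: enn2real_leI)
      then have "\<Lambda>' * \<rho> (Sup K) \<le> \<Lambda>' * l" "S * \<sigma> (Sup K) \<le> S * g" "0 \<le> \<Lambda>' * \<rho> t" "0 \<le> S * \<sigma> t"
        using \<open>0 \<le> \<Lambda>'\<close> \<open>0 \<le> S\<close> by (auto intro: mult_left_mono)
      then show ?thesis by (simp add: W_def)
    qed
    have gap_step: "\<bar>F b - F a\<bar> \<le> S * (\<sigma> b - \<sigma> s)" if "(a, b) \<in> gap_intervals K" "s \<le> a" for a b s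
    proof -
      have "\<bar>F b - F a\<bar> \<le> S * dist (\<gamma> a) (\<gamma> b)" using jumps[OF that(1)] by (simp add: F_def)
      also have "\<dots> \<le> S * (\<sigma> b - \<sigma> s)"
        using \<sigma>_inc[OF that] \<open>0 \<le> S\<close> by (intro mult_left_mono) auto
      finally show ?thesis .
    qed
    have step: "\<exists>t'\<in>K. t < t' \<and> \<bar>F t' - F t\<bar> \<le> W t' - W t"
      if t: "t \<in> K" "Inf K < t" "t < Sup K" for t
    proof (cases "\<gamma> t = \<gamma> (Sup K)")
      case True
      then show ?thesis using t inK W_mono
        by (intro bexI[of _ "Sup K"]) (auto simp: F_def mono_on_def)
    next
      case False
      then have "0 < dist (\<gamma> t) (\<gamma> (Sup K))" by simp
      \<comment> \<open>A scale below the distance to the end point, so that the fragment must leave the ball.\<close>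
      then obtain r where r: "0 < r" "r < dist (\<gamma> t) (\<gamma> (Sup K))"
          "\<forall>y\<in>ball (\<gamma> t) r. \<bar>f (\<gamma> t) - f y\<bar> \<le> \<Lambda>' * r"
        using lip[OF t] \<open>\<Lambda> < \<Lambda>'\<close> unfolding lower_lip_le_iff[OF f] by blast
      obtain t' where t': "t' \<in> K" "t < t'" "r \<le> dist (\<gamma> t) (\<gamma> t')"
          "\<And>u. u \<in> K \<Longrightarrow> t \<le> u \<Longrightarrow> u < t' \<Longrightarrow> dist (\<gamma> t) (\<gamma> u) < r"
        using first_exit[OF K(1) cont t(1) inK(2), of r] t r by auto
      have inside: "\<bar>F u - F t\<bar> \<le> \<Lambda>' * r" if "u \<in> K" "t \<le> u" "u < t'" for u
      proof -
        have "\<bar>f (\<gamma> t) - f (\<gamma> u)\<bar> \<le> \<Lambda>' * r" using t'(4)[OF that] r(3) by simp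
        then show ?thesis by (simp add: F_def abs_minus_commute)
      qed
      have "r \<le> \<rho> t' - \<rho> t" using \<rho>_inc[of t t'] t t' by simp
      then have \<rho>_step: "\<Lambda>' * r \<le> \<Lambda>' * (\<rho> t' - \<rho> t)" using \<open>0 \<le> \<Lambda>'\<close> by (rule mult_left_mono)
      have "\<bar>F t' - F t\<bar> \<le> W t' - W t"
        using K(1) t(1) t'(1,2)
      proof (cases rule: left_limit_or_gap)
        case (limit x)
        have "(\<lambda>n. F (x n)) \<longlonglongrightarrow> F t'"
          using contF limit(1,4) t'(1) by (auto simp: continuous_on_sequentially o_def)
        then have "(\<lambda>n. \<bar>F (x n) - F t\<bar>) \<longlonglongrightarrow> \<bar>F t' - F t\<bar>" by (intro tendsto_intros)
        then have "\<bar>F t' - F t\<bar> \<le> \<Lambda>' * r"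
          by (rule LIMSEQ_le_const2) (use inside limit in auto)
        moreover have "0 \<le> S * (\<sigma> t' - \<sigma> t)" using \<sigma>_mono[of t t'] t' \<open>0 \<le> S\<close> by simp
        ultimately show ?thesis using \<rho>_step by (simp add: W_def algebra_simps)
      next
        case (gap u)
        have "\<bar>F t' - F u\<bar> \<le> S * (\<sigma> t' - \<sigma> t)" by (rule gap_step) (use gap in auto)
        moreover have "\<bar>F u - F t\<bar> \<le> \<Lambda>' * r" by (rule inside) (use gap in auto)
        ultimately show ?thesis using \<rho>_step unfolding W_def right_diff_distrib by linarith
      qed
      then show ?thesis using t' by blast
    qed
    have from_t: "\<bar>F (Sup K) - F t\<bar> \<le> \<Lambda>' * l + S * g" if "t \<in> K" "Inf K < t" for t
    proof -
      have "\<bar>F (Sup K) - F t\<bar> \<le> W (Sup K) - W t"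
        by (rule increment_le_by_continuation[OF K(1) that(1) contF W_mono]) (use that step in auto)
      then show ?thesis using W_end[of t] by linarith
    qed
    show ?thesis
    \<comment> \<open>The bound on \<open>lower_lip f\<close> is not assumed at the start of the fragment: start from later points
       that converge to it, or, if it is isolated in \<open>K\<close>, cross the gap to its right neighbour.\<close>
    proof (cases "\<exists>x. (\<forall>n. x n \<in> K - {Inf K}) \<and> x \<longlonglongrightarrow> Inf K")
      case True
      then obtain x where x: "\<And>n. x n \<in> K - {Inf K}" "x \<longlonglongrightarrow> Inf K" by blast
      have "(\<lambda>n. F (x n)) \<longlonglongrightarrow> F (Inf K)"
        using contF x inK by (auto simp: continuous_on_sequentially o_def)
      then have "(\<lambda>n. \<bar>F (Sup K) - F (x n)\<bar>) \<longlonglongrightarrow> \<bar>F (Sup K) - F (Inf K)\<bar>"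
        by (intro tendsto_intros)
      moreover have "\<bar>F (Sup K) - F (x n)\<bar> \<le> \<Lambda>' * l + S * g" for n
      proof (rule from_t)
        show "x n \<in> K" using x by auto
        show "Inf K < x n" using x(1)[of n] cInf_lower[of "x n" K] bb by auto
      qed
      ultimately show ?thesis by (intro LIMSEQ_le_const2) auto
    next
      case False
      then have isol: "Inf K \<notin> closure (K - {Inf K})" by (auto simp: closure_sequential)
      have "\<bar>F (Sup K) - F (Inf K)\<bar> \<le> W (Sup K) - W (Inf K)"
      proof (rule increment_le_by_continuation[OF K(1) inK(1) contF W_mono])
        fix t assume t: "t \<in> K" "Inf K \<le> t" "t < Sup K"
        show "\<exists>t'\<in>K. t < t' \<and> \<bar>F t' - F t\<bar> \<le> W t' - W t"
        proof (cases "t = Inf K")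
          case True
          define b where "b = Inf (K - {Inf K})"
          have ne: "K - {Inf K} \<noteq> {}" using inK t True by auto
          have bd: "bdd_below (K - {Inf K})" using bb by (auto intro: bdd_below_mono)
          have "b \<in> closure (K - {Inf K})" unfolding b_def using ne bd by (rule closure_contains_Inf)
          moreover have "closure (K - {Inf K}) \<subseteq> K"
            using K by (intro closure_minimal) (auto simp: compact_imp_closed)
          ultimately have b: "b \<in> K" "b \<noteq> Inf K" using isol by auto
          then have lt: "Inf K < b" using cInf_lower[OF b(1) bb(1)] by simp
          have "u \<notin> K" if "u \<in> {Inf K<..<b}" for u
            using that cInf_lower[of u "K - {Inf K}"] bd by (auto simp: b_def)
          then have gp: "(Inf K, b) \<in> gap_intervals K"
            using K inK b lt by (intro consecutive_points_gap_interval) auto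
          have "\<bar>F b - F t\<bar> \<le> S * (\<sigma> b - \<sigma> t)" using gap_step[OF gp] True by simp
          moreover have "0 \<le> \<Lambda>' * (\<rho> b - \<rho> t)"
          proof -
            have "\<rho> t + dist (\<gamma> t) (\<gamma> b) \<le> \<rho> b" by (rule \<rho>_inc) (use t(1) b lt True in auto)
            then have "0 \<le> \<rho> b - \<rho> t" using zero_le_dist[of "\<gamma> t" "\<gamma> b"] by linarith
            then show ?thesis using \<open>0 \<le> \<Lambda>'\<close> by simp
          qed
          ultimately have "\<bar>F b - F t\<bar> \<le> W b - W t"
            unfolding W_def by (simp add: algebra_simps)
          then show ?thesis using b lt True by blast
        next
          case False
          then show ?thesis using step t by simp
        qed
      qed
      then show ?thesis using W_end[of "Inf K"] by linarith
    qed
  qed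
  have "\<bar>F (Sup K) - F (Inf K)\<bar> \<le> \<Lambda> * l + S * g"
  proof (rule field_le_epsilon)
    fix e :: real assume "0 < e"
    have "\<bar>F (Sup K) - F (Inf K)\<bar> \<le> (\<Lambda> + e / (l + 1)) * l + S * g"
      using \<open>0 < e\<close> len(2) by (intro main) simp
    also have "\<dots> = \<Lambda> * l + S * g + e * (l / (l + 1))" by (simp add: algebra_simps)
    also have "e * (l / (l + 1)) \<le> e * 1"
      using \<open>0 < e\<close> len(2) by (intro mult_left_mono) auto
    finally show "\<bar>F (Sup K) - F (Inf K)\<bar> \<le> \<Lambda> * l + S * g + e" by simp
  qed
  then show ?thesis by (simp add: F_def)
qed

section \<open>Coverings and the weak type estimate\<close>

text \<open>
  Greedy selection by decreasing radius: a ball that meets a selected ball of at least its own radius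
lies in the threefold enlargement of that ball.
\<close>
lemma finite_vitali_covering:
  fixes c :: "'i \<Rightarrow> 'a::metric_space" and r :: "'i \<Rightarrow> real"
  assumes "finite I" and "\<And>i. i \<in> I \<Longrightarrow> 0 < r i"
  shows "\<exists>J\<subseteq>I. disjoint_family_on (\<lambda>j. ball (c j) (r j)) J \<and>
           (\<Union>i\<in>I. ball (c i) (r i)) \<subseteq> (\<Union>j\<in>J. ball (c j) (3 * r j))"
  using assms
proof (induction I rule: finite_psubset_induct)
  case (psubset I)
  let ?B = "\<lambda>i. ball (c i) (r i)"
  show ?case
  proof (cases "I = {}")
    case True
    then show ?thesis by (auto simp: disjoint_family_on_def)
  next
    case False
    have "Max (r ` I) \<in> r ` I" using False psubset.hyps by (intro Max_in) auto
    then obtain m where m: "m \<in> I" "r m = Max (r ` I)" by auto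
    have max: "r i \<le> r m" if "i \<in> I" for i using that m psubset.hyps by simp
    define I' where "I' = {i\<in>I. ?B i \<inter> ?B m = {}}"
    have "c m \<in> ?B m" using psubset.prems[OF m(1)] by simp
    then have "m \<notin> I'" by (auto simp: I'_def)
    moreover have "I' \<subseteq> I" by (auto simp: I'_def)
    ultimately have "I' \<subset> I" using m(1) by blast
    then obtain J where J: "J \<subseteq> I'" "disjoint_family_on ?B J"
        "(\<Union>i\<in>I'. ?B i) \<subseteq> (\<Union>j\<in>J. ball (c j) (3 * r j))"
      using psubset.IH[of I'] psubset.prems by blast
    have "?B i \<subseteq> (\<Union>j\<in>insert m J. ball (c j) (3 * r j))" if i: "i \<in> I" for i
    proof (cases "i \<in> I'")
      case True
      then show ?thesis using J by blast
    next
      case False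
      then obtain w where w: "dist (c i) w < r i" "dist (c m) w < r m" using i by (auto simp: I'_def)
      have "?B i \<subseteq> ball (c m) (3 * r m)"
      proof
        fix y assume "y \<in> ?B i"
        then have y: "dist (c i) y < r i" by simp
        have "dist (c m) y \<le> dist (c m) w + dist w (c i) + dist (c i) y"
          by (metis add.commute add_left_mono dist_triangle order_trans)
        then show "y \<in> ball (c m) (3 * r m)"
          using w y max[OF i] by (simp add: dist_commute)
      qed
      then show ?thesis by blast
    qed
    moreover have "disjoint_family_on ?B (insert m J)"
      using J(1,2) unfolding disjoint_family_on_def I'_def by blast
    ultimately show ?thesis
      using J(1) m \<open>I' \<subset> I\<close> by (intro exI[of _ "insert m J"]) blast
  qed
qed

lemma doubling_iterate:
  assumes "doubling \<mu> D r\<^sub>0" "0 \<le> D" "0 < r" "2 ^ k * r \<le> r\<^sub>0"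
  shows "measure \<mu> (ball x (2 ^ k * r)) \<le> D ^ k * measure \<mu> (ball x r)"
  using assms(4)
proof (induction k)
  case (Suc k)
  have "0 < 2 ^ k * r" using \<open>0 < r\<close> by simp
  then have lt: "2 ^ k * r < r\<^sub>0" using Suc.prems by simp
  have "measure \<mu> (ball x (2 ^ Suc k * r)) \<le> D * measure \<mu> (ball x (2 ^ k * r))"
    using assms(1)[unfolded doubling_def, rule_format, of "2 ^ k * r" x] lt \<open>0 < 2 ^ k * r\<close>
    by (simp add: mult.assoc)
  also have "\<dots> \<le> D * (D ^ k * measure \<mu> (ball x r))"
    using Suc.IH lt \<open>0 \<le> D\<close> by (intro mult_left_mono) auto
  finally show ?case by simp
qed simp

definition finite_on_balls :: "'a::metric_space measure \<Rightarrow> bool" where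
  "finite_on_balls \<mu> \<longleftrightarrow> sets \<mu> = sets borel \<and> (\<forall>x r. emeasure \<mu> (ball x r) < \<infinity>)"

lemma finite_on_balls_fmeasurable:
  assumes "finite_on_balls \<mu>" "A \<in> sets borel" "A \<subseteq> ball x r"
  shows "A \<in> fmeasurable \<mu>"
proof (rule fmeasurableI)
  show "A \<in> sets \<mu>" using assms by (simp add: finite_on_balls_def)
  have "emeasure \<mu> A \<le> emeasure \<mu> (ball x r)"
    using assms by (intro emeasure_mono) (simp_all add: finite_on_balls_def)
  also have "\<dots> < \<infinity>" using assms by (simp add: finite_on_balls_def)
  finally show "emeasure \<mu> A < \<infinity>" .
qed

lemma measure_ball_mono:
  assumes "finite_on_balls \<mu>" "A \<in> sets borel" "A \<subseteq> ball x r"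
  shows "measure \<mu> A \<le> measure \<mu> (ball x r)"
proof (rule measure_mono_fmeasurable[OF assms(3)])
  show "A \<in> sets \<mu>" using assms by (simp add: finite_on_balls_def)
  show "ball x r \<in> fmeasurable \<mu>" by (rule finite_on_balls_fmeasurable[OF assms(1), of _ x r]) simp_all
qed

text \<open>
  The set where the centred maximal function of \<open>\<nu>\<close> relative to \<open>\<mu>\<close>, restricted to radii up to \<open>R\<close>,
exceeds \<open>c\<close>.
\<close>
definition excess_set ::
    "'a::metric_space measure \<Rightarrow> 'a measure \<Rightarrow> real \<Rightarrow> real \<Rightarrow> 'a set" where
  "excess_set \<nu> \<mu> c R =
     {z. \<exists>\<rho>. 0 < \<rho> \<and> \<rho> \<le> R \<and> c * measure \<mu> (ball z \<rho>) < measure \<nu> (ball z \<rho>)}"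

text \<open>
  A ball with excess keeps it when slightly shrunk, by continuity of \<open>\<nu>\<close> from below; the shrunken
ball lies in the balls of intermediate radius around all points near its centre.
\<close>
lemma open_excess_set:
  assumes \<nu>: "finite_on_balls \<nu>" and \<mu>: "finite_on_balls \<mu>" and "0 \<le> c"
  shows "open (excess_set \<nu> \<mu> c R)"
  unfolding open_contains_ball
proof
  fix z assume "z \<in> excess_set \<nu> \<mu> c R"
  then obtain \<rho> where \<rho>: "0 < \<rho>" "\<rho> \<le> R" "c * measure \<mu> (ball z \<rho>) < measure \<nu> (ball z \<rho>)"
    by (auto simp: excess_set_def)
  let ?A = "\<lambda>n. ball z (\<rho> - 1 / real (Suc n))"
  have un: "(\<Union>n. ?A n) = ball z \<rho>"
  proof
    show "ball z \<rho> \<subseteq> (\<Union>n. ?A n)"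
    proof
      fix y assume "y \<in> ball z \<rho>"
      then have "0 < \<rho> - dist z y" by simp
      then obtain n where "1 / real (Suc n) < \<rho> - dist z y"
        using reals_Archimedean[of "\<rho> - dist z y"] by (auto simp: inverse_eq_divide)
      then have "y \<in> ?A n" by simp
      then show "y \<in> (\<Union>n. ?A n)" by blast
    qed
    have "?A n \<subseteq> ball z \<rho>" for n by (intro subset_ball) simp
    then show "(\<Union>n. ?A n) \<subseteq> ball z \<rho>" by blast
  qed
  have "(\<lambda>n. measure \<nu> (?A n)) \<longlonglongrightarrow> measure \<nu> (\<Union>n. ?A n)"
  proof (rule Lim_measure_incseq)
    show "incseq ?A" by (intro incseq_SucI subset_ball) (simp add: frac_le)
    show "range ?A \<subseteq> sets \<nu>" using \<nu> by (auto simp: finite_on_balls_def)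
    have "emeasure \<nu> (ball z \<rho>) < \<infinity>" using \<nu> by (simp add: finite_on_balls_def)
    then show "emeasure \<nu> (\<Union>n. ?A n) \<noteq> \<infinity>" unfolding un by simp
  qed
  then have "\<forall>\<^sub>F n in sequentially. c * measure \<mu> (ball z \<rho>) < measure \<nu> (?A n)"
    using \<rho>(3) unfolding un by (rule order_tendstoD)
  then obtain n where n: "c * measure \<mu> (ball z \<rho>) < measure \<nu> (?A n)"
    by (auto simp: eventually_sequentially)
  define d where "d = 1 / (2 * real (Suc n))"
  have d: "0 < d" "2 * d = 1 / real (Suc n)" by (simp_all add: d_def divide_simps)
  have "0 < \<rho> - 2 * d"
  proof (rule ccontr)
    assume "\<not> ?thesis"
    then have "?A n = {}" using d by (simp add: ball_empty)
    then have "measure \<nu> (?A n) = 0" by (simp only: measure_empty)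
    moreover have "0 \<le> c * measure \<mu> (ball z \<rho>)" using \<open>0 \<le> c\<close> by simp
    ultimately show False using n by linarith
  qed
  have "w \<in> excess_set \<nu> \<mu> c R" if w: "w \<in> ball z d" for w
  proof -
    have sub1: "?A n \<subseteq> ball w (\<rho> - d)"
    proof
      fix y assume "y \<in> ?A n"
      then have "dist z y < \<rho> - 2 * d" using d by simp
      then show "y \<in> ball w (\<rho> - d)" using w dist_triangle3[of w y z] by (simp add: dist_commute)
    qed
    have sub2: "ball w (\<rho> - d) \<subseteq> ball z \<rho>"
    proof
      fix y assume "y \<in> ball w (\<rho> - d)"
      then show "y \<in> ball z \<rho>" using w dist_triangle[of z y w] by simp
    qed
    have "c * measure \<mu> (ball w (\<rho> - d)) \<le> c * measure \<mu> (ball z \<rho>)"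
      using \<open>0 \<le> c\<close> by (intro mult_left_mono measure_ball_mono[OF \<mu>] sub2) auto
    also have "\<dots> < measure \<nu> (?A n)" by (rule n)
    also have "\<dots> \<le> measure \<nu> (ball w (\<rho> - d))" by (intro measure_ball_mono[OF \<nu>] sub1) auto
    finally show ?thesis
      using \<rho> d \<open>0 < \<rho> - 2 * d\<close> by (auto simp: excess_set_def intro!: exI[of _ "\<rho> - d"])
  qed
  then show "\<exists>e>0. ball z e \<subseteq> excess_set \<nu> \<mu> c R" using d by blast
qed

text \<open>
  The weak type estimate. As the set is open, inner regularity reduces it to compact subsets. These are
covered by finitely many balls with excess, so a finite covering lemma suffices; the threefold
enlargements cost two doublings.
\<close>
lemma measure_excess_set_le:
  fixes \<mu> \<nu> :: "'a::metric_space measure"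
  assumes \<nu>: "finite_on_balls \<nu>" and \<mu>: "finite_on_balls \<mu>" and "radon_measure \<mu>"
    and "doubling \<mu> D r\<^sub>0" "0 \<le> D" "0 < R" "2 * R < r\<^sub>0" "0 < c"
  shows "measure \<mu> (excess_set \<nu> \<mu> c R \<inter> ball x R) \<le> D ^ 2 / c * measure \<nu> (ball x (2 * R))"
proof -
  let ?U = "excess_set \<nu> \<mu> c R \<inter> ball x R" and ?b = "D ^ 2 / c * measure \<nu> (ball x (2 * R))"
  have "0 \<le> ?b" using \<open>0 \<le> D\<close> \<open>0 < c\<close> by simp
  have "open ?U" using open_excess_set[OF \<nu> \<mu>] \<open>0 < c\<close> by auto
  then have "emeasure \<mu> ?U = (SUP K\<in>{K. compact K \<and> K \<subseteq> ?U}. emeasure \<mu> K)"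
    using \<open>radon_measure \<mu>\<close> unfolding radon_measure_def by blast
  also have "\<dots> \<le> ennreal ?b"
  proof (rule SUP_least)
    fix K assume "K \<in> {K. compact K \<and> K \<subseteq> ?U}"
    then have K: "compact K" "K \<subseteq> ?U" by auto
    have "\<forall>z\<in>K. \<exists>\<rho>. 0 < \<rho> \<and> \<rho> \<le> R \<and> c * measure \<mu> (ball z \<rho>) < measure \<nu> (ball z \<rho>)"
      using K(2) by (auto simp: excess_set_def)
    then obtain \<rho> where \<rho>: "\<And>z. z \<in> K \<Longrightarrow> 0 < \<rho> z" "\<And>z. z \<in> K \<Longrightarrow> \<rho> z \<le> R"
        "\<And>z. z \<in> K \<Longrightarrow> c * measure \<mu> (ball z (\<rho> z)) < measure \<nu> (ball z (\<rho> z))"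
      by metis
    have "K \<subseteq> (\<Union>z\<in>K. ball z (\<rho> z))" using \<rho>(1) by force
    then obtain I where I: "I \<subseteq> K" "finite I" "K \<subseteq> (\<Union>z\<in>I. ball z (\<rho> z))"
      using compactE_image[OF K(1), of K "\<lambda>z. ball z (\<rho> z)"] by (metis open_ball)
    then obtain J where J: "J \<subseteq> I" "disjoint_family_on (\<lambda>z. ball z (\<rho> z)) J"
        "(\<Union>z\<in>I. ball z (\<rho> z)) \<subseteq> (\<Union>z\<in>J. ball z (3 * \<rho> z))"
      using finite_vitali_covering[of I \<rho> "\<lambda>z. z"] \<rho>(1) by blast
    have fJ: "finite J" and JK: "J \<subseteq> K" using I J by (auto intro: finite_subset)
    have small: "ball z (\<rho> z) \<subseteq> ball x (2 * R)" if "z \<in> J" for z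
    proof
      fix y assume "y \<in> ball z (\<rho> z)"
      moreover have "dist x z < R" "\<rho> z \<le> R" using that JK K(2) \<rho>(2) by auto
      ultimately show "y \<in> ball x (2 * R)" using dist_triangle[of x y z] by simp
    qed
    have each: "measure \<mu> (ball z (3 * \<rho> z)) \<le> D ^ 2 / c * measure \<nu> (ball z (\<rho> z))" if "z \<in> J" for z
    proof -
      have z: "0 < \<rho> z" "\<rho> z \<le> R" "c * measure \<mu> (ball z (\<rho> z)) < measure \<nu> (ball z (\<rho> z))"
        using that JK \<rho> by auto
      have d: "measure \<mu> (ball z (2 * t)) \<le> D * measure \<mu> (ball z t)" if "0 < t" "t < r\<^sub>0" for t
        using \<open>doubling \<mu> D r\<^sub>0\<close> that by (simp add: doubling_def)
      have "measure \<mu> (ball z (3 * \<rho> z)) \<le> measure \<mu> (ball z (2 * (2 * \<rho> z)))"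
        by (intro measure_ball_mono[OF \<mu>] subset_ball) (use z in auto)
      also have "\<dots> \<le> D * measure \<mu> (ball z (2 * \<rho> z))"
        by (rule d) (use z \<open>2 * R < r\<^sub>0\<close> in auto)
      also have "\<dots> \<le> D * (D * measure \<mu> (ball z (\<rho> z)))"
        using z \<open>0 \<le> D\<close> \<open>2 * R < r\<^sub>0\<close> by (intro mult_left_mono d) auto
      also have "\<dots> = D ^ 2 / c * (c * measure \<mu> (ball z (\<rho> z)))"
        using \<open>0 < c\<close> by (simp add: power2_eq_square)
      also have "\<dots> \<le> D ^ 2 / c * measure \<nu> (ball z (\<rho> z))"
        using z \<open>0 < c\<close> by (intro mult_left_mono) auto
      finally show ?thesis .
    qed
    have fmK: "K \<in> fmeasurable \<mu>"
      by (rule finite_on_balls_fmeasurable[OF \<mu>, of _ x R]) (use K in \<open>auto simp: compact_imp_closed\<close>)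
    have fm3: "ball z s \<in> fmeasurable \<mu>" for z s
      by (rule finite_on_balls_fmeasurable[OF \<mu>, of _ z s]) auto
    have fm\<nu>: "ball z s \<in> fmeasurable \<nu>" for z s
      by (rule finite_on_balls_fmeasurable[OF \<nu>, of _ z s]) auto
    have "measure \<mu> K \<le> measure \<mu> (\<Union>z\<in>J. ball z (3 * \<rho> z))"
      using I J fmK fm3 fJ by (intro measure_mono_fmeasurable fmeasurable.finite_UN) auto
    also have "\<dots> \<le> (\<Sum>z\<in>J. measure \<mu> (ball z (3 * \<rho> z)))"
      using fJ fm3 by (intro measure_UNION_le) auto
    also have "\<dots> \<le> (\<Sum>z\<in>J. D ^ 2 / c * measure \<nu> (ball z (\<rho> z)))"
      by (intro sum_mono each)
    also have "\<dots> = D ^ 2 / c * (\<Sum>z\<in>J. measure \<nu> (ball z (\<rho> z)))"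
      by (simp add: sum_distrib_left)
    also have "(\<Sum>z\<in>J. measure \<nu> (ball z (\<rho> z))) = measure \<nu> (\<Union>z\<in>J. ball z (\<rho> z))"
      using fJ J(2) fmeasurableD[OF fm\<nu>] fmeasurableD2[OF fm\<nu>]
      by (intro measure_finite_Union[symmetric]) auto
    also have "D ^ 2 / c * \<dots> \<le> ?b"
      using small \<open>0 < c\<close> by (intro mult_left_mono measure_ball_mono[OF \<nu>] borel_open open_UN) auto
    finally have "measure \<mu> K \<le> ?b" by simp
    then show "emeasure \<mu> K \<le> ennreal ?b"
      using fmK by (metis emeasure_eq_measure2 ennreal_leI)
  qed
  finally show ?thesis using \<open>0 \<le> ?b\<close> unfolding measure_def by (rule enn2real_leI[rotated])
qed

section \<open>Lower semicontinuous majorants\<close>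

text \<open>
  The layer sum of \<open>y\<close> in steps of height \<open>\<theta>\<close>.
\<close>
lemma card_multiples_le:
  fixes \<theta> y :: real
  assumes "0 < \<theta>" "0 \<le> y"
  shows "(\<Sum>k\<in>{1..n}. \<theta> * (if real k * \<theta> \<le> y then 1 else 0)) \<le> y"
proof -
  have "{k\<in>{1..n}. real k * \<theta> \<le> y} \<subseteq> {1..nat \<lfloor>y / \<theta>\<rfloor>}"
  proof
    fix k assume k: "k \<in> {k\<in>{1..n}. real k * \<theta> \<le> y}"
    then have "real k \<le> y / \<theta>" using \<open>0 < \<theta>\<close> by (simp add: field_simps)
    then show "k \<in> {1..nat \<lfloor>y / \<theta>\<rfloor>}" using k by (auto simp: le_nat_floor)
  qed
  then have "card {k\<in>{1..n}. real k * \<theta> \<le> y} \<le> card {1..nat \<lfloor>y / \<theta>\<rfloor>}"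
    by (rule card_mono[rotated]) simp
  then have "real (card {k\<in>{1..n}. real k * \<theta> \<le> y}) \<le> real (nat \<lfloor>y / \<theta>\<rfloor>)" by simp
  also have "\<dots> \<le> y / \<theta>" using assms by (intro of_nat_floor) simp
  finally have "real (card {k\<in>{1..n}. real k * \<theta> \<le> y}) \<le> y / \<theta>" .
  then have "\<theta> * real (card {k\<in>{1..n}. real k * \<theta> \<le> y}) \<le> y"
    using \<open>0 < \<theta>\<close> by (simp add: field_simps)
  moreover have "(\<Sum>k\<in>{1..n}. \<theta> * (if real k * \<theta> \<le> y then 1 else 0)) =
      \<theta> * real (card {k\<in>{1..n}. real k * \<theta> \<le> y})"
    by (simp add: sum_distrib_left[symmetric] sum.If_cases Int_def)
  ultimately show ?thesis by simp
qed

text \<open>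
  A form of the Vitali-Caratheodory theorem. Slice \<open>h\<close> into layers of height \<open>\<theta>\<close> and enlarge each
superlevel set \<open>A k\<close> to an open set \<open>U k\<close> of nearly the same measure. The density
\<open>\<theta> (1 + \<Sum>k. indicator (U k))\<close> is lower semicontinuous and at least \<open>h\<close> on \<open>B\<close>. Near \<open>z\<close> it
is therefore at least \<open>h z\<close>, which is the last conclusion; the extra layer makes up for the rounding.
\<close>
lemma lower_semicontinuous_majorant_measure:
  fixes \<mu> :: "'a::metric_space measure" and h :: "'a \<Rightarrow> real"
  assumes radon: "radon_measure \<mu>" and \<mu>: "finite_on_balls \<mu>"
    and B: "B \<in> sets borel" "emeasure \<mu> B < \<infinity>"
    and h: "h \<in> borel_measurable borel" "\<And>z. 0 \<le> h z" "\<And>z. h z \<le> H"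
    and "0 < \<epsilon>"
  obtains \<nu> where "finite_on_balls \<nu>"
    "measure \<nu> B \<le> (LINT x:B|\<mu>. h x) + \<epsilon>"
    "\<And>z. z \<in> B \<Longrightarrow> \<exists>\<delta>>0. \<forall>\<rho>. 0 < \<rho> \<and> \<rho> < \<delta> \<longrightarrow> h z * measure \<mu> (ball z \<rho>) \<le> measure \<nu> (ball z \<rho>)"
proof -
  have sets: "sets \<mu> = sets borel" using radon by (simp add: radon_measure_def)
  define \<theta> where "\<theta> = \<epsilon> / (2 * (measure \<mu> B + 1))"
  have \<theta>: "0 < \<theta>" "\<theta> * measure \<mu> B \<le> \<epsilon> / 2"
  proof -
    have p: "0 < measure \<mu> B + 1" using measure_nonneg[of \<mu> B] by linarith
    then show "0 < \<theta>" using \<open>0 < \<epsilon>\<close> by (simp add: \<theta>_def)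
    have "\<theta> * measure \<mu> B \<le> \<theta> * (measure \<mu> B + 1)" using \<open>0 < \<theta>\<close> by simp
    also have "\<dots> = \<epsilon> / 2" using p by (simp add: \<theta>_def field_simps)
    finally show "\<theta> * measure \<mu> B \<le> \<epsilon> / 2" .
  qed
  define n where "n = nat \<lceil>H / \<theta>\<rceil>"
  define \<eta> where "\<eta> = \<epsilon> / (2 * \<theta> * (real n + 1))"
  have \<eta>: "0 < \<eta>" "real n * (\<theta> * \<eta>) \<le> \<epsilon> / 2"
    using \<theta>(1) \<open>0 < \<epsilon>\<close> by (auto simp: \<eta>_def divide_simps)
  define A where "A = (\<lambda>k::nat. {x\<in>B. real k * \<theta> \<le> h x})"
  have A: "A k \<in> sets borel" "A k \<subseteq> B" for k
  proof -
    have "A k = B \<inter> {x\<in>space borel. real k * \<theta> \<le> h x}" by (auto simp: A_def)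
    also have "\<dots> \<in> sets borel" using B(1) h(1) by measurable
    finally show "A k \<in> sets borel" .
  qed (auto simp: A_def)
  have finA: "emeasure \<mu> (A k) < \<infinity>" for k
    using emeasure_mono[OF A(2)[of k], of \<mu>] B by (auto simp: sets le_less_trans)
  have "\<exists>U. open U \<and> A k \<subseteq> U \<and> emeasure \<mu> U < ennreal (measure \<mu> (A k) + \<eta>)" for k
  proof -
    have "emeasure \<mu> (A k) = ennreal (measure \<mu> (A k))"
      using finA[of k] by (intro emeasure_eq_ennreal_measure) auto
    then have "emeasure \<mu> (A k) < ennreal (measure \<mu> (A k) + \<eta>)" using \<eta>(1) by (metis ennreal_lessI add_nonneg_pos less_add_same_cancel1 measure_nonneg)
    moreover have "emeasure \<mu> (A k) = (INF U\<in>{U. open U \<and> A k \<subseteq> U}. emeasure \<mu> U)"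
      using radon A(1)[of k] unfolding radon_measure_def by blast
    ultimately have "(INF U\<in>{U. open U \<and> A k \<subseteq> U}. emeasure \<mu> U) < ennreal (measure \<mu> (A k) + \<eta>)" by metis
    then show ?thesis by (auto simp: INF_less_iff)
  qed
  then obtain U where U: "\<And>k. open (U k)" "\<And>k. A k \<subseteq> U k"
      "\<And>k. emeasure \<mu> (U k) < ennreal (measure \<mu> (A k) + \<eta>)" by metis
  have Ub: "U k \<in> sets borel" for k using U(1) by simp
  define w where "w = (\<lambda>x. ennreal \<theta> + (\<Sum>k\<in>{1..n}. ennreal \<theta> * indicator (U k) x))"
  define \<nu> where "\<nu> = density \<mu> w"
  have w_meas: "w \<in> borel_measurable \<mu>"
  proof -
    have [measurable]: "U k \<in> sets \<mu>" for k using Ub by (simp add: sets)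
    show ?thesis unfolding w_def by measurable
  qed
  have em\<nu>: "emeasure \<nu> E = ennreal \<theta> * emeasure \<mu> E + (\<Sum>k\<in>{1..n}. ennreal \<theta> * emeasure \<mu> (U k \<inter> E))"
    if E: "E \<in> sets borel" for E
  proof -
    have "emeasure \<nu> E = (\<integral>\<^sup>+ x. w x * indicator E x \<partial>\<mu>)"
      unfolding \<nu>_def using w_meas E by (intro emeasure_density) (auto simp: sets)
    also have "\<dots> = (\<integral>\<^sup>+ x. ennreal \<theta> * indicator E x + (\<Sum>k\<in>{1..n}. ennreal \<theta> * indicator (U k \<inter> E) x) \<partial>\<mu>)"
      by (intro nn_integral_cong) (auto simp: w_def indicator_def)
    also have "\<dots> = (\<integral>\<^sup>+ x. ennreal \<theta> * indicator E x \<partial>\<mu>) +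
        (\<Sum>k\<in>{1..n}. \<integral>\<^sup>+ x. ennreal \<theta> * indicator (U k \<inter> E) x \<partial>\<mu>)"
    proof -
      have [measurable]: "E \<in> sets \<mu>" "U k \<in> sets \<mu>" for k using E Ub by (simp_all add: sets)
      show ?thesis by (subst nn_integral_add, measurable, subst nn_integral_sum, measurable)
    qed
    also have "\<dots> = ennreal \<theta> * emeasure \<mu> E + (\<Sum>k\<in>{1..n}. ennreal \<theta> * emeasure \<mu> (U k \<inter> E))"
    proof -
      have "E \<in> sets \<mu>" "U k \<inter> E \<in> sets \<mu>" for k using E Ub by (simp_all add: sets)
      then show ?thesis by (simp only: nn_integral_cmult_indicator)
    qed
    finally show ?thesis .
  qed
  have m\<nu>: "emeasure \<nu> E < \<infinity>"
    "measure \<nu> E = \<theta> * measure \<mu> E + (\<Sum>k\<in>{1..n}. \<theta> * measure \<mu> (U k \<inter> E))"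
    if E: "E \<in> sets borel" "emeasure \<mu> E < \<infinity>" for E
  proof -
    have fin: "emeasure \<mu> (U k \<inter> E) < \<infinity>" for k
      using emeasure_mono[of "U k \<inter> E" E \<mu>] E by (auto simp: sets le_less_trans)
    have "emeasure \<nu> E = ennreal \<theta> * ennreal (measure \<mu> E) + (\<Sum>k\<in>{1..n}. ennreal \<theta> * ennreal (measure \<mu> (U k \<inter> E)))"
      unfolding em\<nu>[OF E(1)] using E(2) fin by (simp add: emeasure_eq_ennreal_measure less_top)
    also have "\<dots> = ennreal (\<theta> * measure \<mu> E + (\<Sum>k\<in>{1..n}. \<theta> * measure \<mu> (U k \<inter> E)))"
      using \<theta>(1) by (simp add: ennreal_mult[symmetric] sum_nonneg ennreal_plus[symmetric] del: ennreal_plus)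
    finally have eq: "emeasure \<nu> E = ennreal (\<theta> * measure \<mu> E + (\<Sum>k\<in>{1..n}. \<theta> * measure \<mu> (U k \<inter> E)))" .
    then show "emeasure \<nu> E < \<infinity>" by simp
    show "measure \<nu> E = \<theta> * measure \<mu> E + (\<Sum>k\<in>{1..n}. \<theta> * measure \<mu> (U k \<inter> E))"
      unfolding measure_def[of \<nu>] eq using \<theta>(1) by (intro enn2real_ennreal) (auto intro!: add_nonneg_nonneg sum_nonneg)
  qed
  show thesis
  proof
    show "finite_on_balls \<nu>"
      using \<mu> m\<nu>(1) unfolding finite_on_balls_def by (auto simp: \<nu>_def)
    have "measure \<nu> B \<le> \<theta> * measure \<mu> B + (\<Sum>k\<in>{1..n}. \<theta> * (measure \<mu> (A k) + \<eta>))"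
      unfolding m\<nu>(2)[OF B]
    proof (intro add_left_mono sum_mono mult_left_mono)
      fix k
      have "emeasure \<mu> (U k \<inter> B) \<le> emeasure \<mu> (U k)" using Ub by (intro emeasure_mono) (auto simp: sets)
      also note U(3)[of k]
      finally show "measure \<mu> (U k \<inter> B) \<le> measure \<mu> (A k) + \<eta>"
        unfolding measure_def[of \<mu> "U k \<inter> B"] using \<eta>(1) by (intro enn2real_leI) auto
    qed (use \<theta> in auto)
    also have "\<dots> = \<theta> * measure \<mu> B + real n * (\<theta> * \<eta>) + (\<Sum>k\<in>{1..n}. \<theta> * measure \<mu> (A k))"
      by (simp add: algebra_simps sum.distrib)
    also have "\<dots> \<le> \<epsilon> + (\<Sum>k\<in>{1..n}. \<theta> * measure \<mu> (A k))" using \<theta>(2) \<eta>(2) by simp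
    also have "(\<Sum>k\<in>{1..n}. \<theta> * measure \<mu> (A k)) = (LINT x|\<mu>. (\<Sum>k\<in>{1..n}. \<theta> * indicator (A k) x))"
      using A finA by (subst Bochner_Integration.integral_sum) (auto simp: sets)
    also have "\<dots> \<le> (LINT x:B|\<mu>. h x)" unfolding set_lebesgue_integral_def
    proof (rule integral_mono)
      show "integrable \<mu> (\<lambda>x. \<Sum>k\<in>{1..n}. \<theta> * indicator (A k) x)"
        using A finA by (intro Bochner_Integration.integrable_sum integrable_mult_right integrable_real_indicator) (auto simp: sets)
      show "integrable \<mu> (\<lambda>x. indicator B x *\<^sub>R h x)"
        using B h by (intro integrableI_bounded_set_indicator[where B=H]) (auto simp: sets measurable_cong_sets[OF sets refl])
      fix x
      show "(\<Sum>k\<in>{1..n}. \<theta> * indicator (A k) x) \<le> indicator B x *\<^sub>R h x"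
      proof (cases "x \<in> B")
        case True
        then have "(\<Sum>k\<in>{1..n}. \<theta> * indicator (A k) x) = (\<Sum>k\<in>{1..n}. \<theta> * (if real k * \<theta> \<le> h x then 1 else 0))"
          by (intro sum.cong) (auto simp: A_def indicator_def)
        also have "\<dots> \<le> h x" by (rule card_multiples_le) (use \<theta> h in auto)
        finally show ?thesis using True by simp
      qed (auto simp: A_def)
    qed
    finally show "measure \<nu> B \<le> (LINT x:B|\<mu>. h x) + \<epsilon>" by simp
  next
    fix z assume z: "z \<in> B"
    define m where "m = nat \<lfloor>h z / \<theta>\<rfloor>"
    have m_le: "real m \<le> h z / \<theta>" and m_ge: "h z / \<theta> < real m + 1"
      using h(2)[of z] \<theta>(1) by (auto simp: m_def of_nat_floor)
    have "h z / \<theta> \<le> H / \<theta>" using h(3) \<theta>(1) by (intro divide_right_mono) auto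
    then have "m \<le> n" unfolding m_def n_def by linarith
    have "z \<in> A k" if "k \<le> m" for k
    proof -
      have "real k \<le> h z / \<theta>" using that m_le by linarith
      then show ?thesis using z \<theta>(1) by (simp add: A_def field_simps)
    qed
    then have zU: "z \<in> (\<Inter>k\<in>{..m}. U k)" using U(2) by blast
    have "open (\<Inter>k\<in>{..m}. U k)" using U(1) by auto
    then obtain \<delta> where \<delta>: "0 < \<delta>" "ball z \<delta> \<subseteq> (\<Inter>k\<in>{..m}. U k)"
      using zU by (rule openE)
    have "h z * measure \<mu> (ball z \<rho>) \<le> measure \<nu> (ball z \<rho>)" if \<rho>: "0 < \<rho>" "\<rho> < \<delta>" for \<rho>
    proof -
      have fin: "emeasure \<mu> (ball z \<rho>) < \<infinity>" using \<mu> by (simp add: finite_on_balls_def)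
      have "ball z \<rho> \<subseteq> ball z \<delta>" using \<rho> by (intro subset_ball) simp
      then have eq: "U k \<inter> ball z \<rho> = ball z \<rho>" if "k \<le> m" for k using \<delta>(2) that by blast
      have "h z * measure \<mu> (ball z \<rho>) \<le> (\<theta> * (real m + 1)) * measure \<mu> (ball z \<rho>)"
        using m_ge \<theta>(1) by (intro mult_right_mono) (auto simp: field_simps)
      also have "\<dots> = \<theta> * measure \<mu> (ball z \<rho>) + (\<Sum>k\<in>{1..m}. \<theta> * measure \<mu> (U k \<inter> ball z \<rho>))"
        using eq by (simp add: algebra_simps)
      also have "\<dots> \<le> \<theta> * measure \<mu> (ball z \<rho>) + (\<Sum>k\<in>{1..n}. \<theta> * measure \<mu> (U k \<inter> ball z \<rho>))"
        using \<open>m \<le> n\<close> \<theta>(1) by (intro add_left_mono sum_mono2) auto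
      also have "\<dots> = measure \<nu> (ball z \<rho>)" using m\<nu>(2)[OF _ fin] by simp
      finally show ?thesis .
    qed
    then show "\<exists>\<delta>>0. \<forall>\<rho>. 0 < \<rho> \<and> \<rho> < \<delta> \<longrightarrow> h z * measure \<mu> (ball z \<rho>) \<le> measure \<nu> (ball z \<rho>)"
      using \<delta>(1) by blast
  qed
qed

section \<open>Filling gaps\<close>

text \<open>
  The estimates below take place in a region \<open>\<Omega>\<close>, on which \<open>\<nu>\<close> dominates the \<open>p\<close>-th power of
\<open>lower_lip f\<close> in the infinitesimal sense just established. Fine connectivity is used at the one
level \<open>D ^ 4 / M powr p\<close>.
\<close>
locale gap_filling =
  fixes \<mu> \<nu> :: "'a::metric_space measure" and f :: "'a \<Rightarrow> real" and \<Omega> :: "'a set"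
    and D r\<^sub>0 C M p \<delta> L :: real
  assumes \<mu>: "finite_on_balls \<mu>" and \<nu>: "finite_on_balls \<nu>" and radon: "radon_measure \<mu>"
    and pos: "\<And>x r. 0 < r \<Longrightarrow> 0 < measure \<mu> (ball x r)"
    and doubling: "doubling \<mu> D r\<^sub>0" and D: "1 < D"
    and C: "1 \<le> C" and M: "0 < M" and p: "0 < p"
    and \<delta>: "0 \<le> \<delta>" "\<delta> \<le> 1 / 2" "M * \<delta> < 1"
    and conn: "connected_space \<mu> C \<delta> (D ^ 4 / M powr p) r\<^sub>0"
    and f: "L-lipschitz_on UNIV f"
    and dominates: "\<And>z. z \<in> \<Omega> \<Longrightarrow> \<exists>d>0. \<forall>\<rho>. 0 < \<rho> \<and> \<rho> < d \<longrightarrow>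
        lower_lip f z powr p * measure \<mu> (ball z \<rho>) \<le> measure \<nu> (ball z \<rho>)"
begin

lemma lower_lip_le_off_excess_set:
  assumes "z \<in> \<Omega>" "z \<notin> excess_set \<nu> \<mu> (\<Lambda> powr p) R" "0 < R" "0 < \<Lambda>"
  shows "lower_lip f z \<le> \<Lambda>"
proof (rule ccontr)
  assume "\<not> ?thesis"
  then have lt: "\<Lambda> powr p < lower_lip f z powr p"
    using \<open>0 < \<Lambda>\<close> p by (intro powr_less_mono2) auto
  obtain d where d: "0 < d" "\<And>\<rho>. 0 < \<rho> \<Longrightarrow> \<rho> < d \<Longrightarrow>
      lower_lip f z powr p * measure \<mu> (ball z \<rho>) \<le> measure \<nu> (ball z \<rho>)"
    using dominates[OF assms(1)] by blast
  define \<rho> where "\<rho> = min (d / 2) R"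
  have \<rho>: "0 < \<rho>" "\<rho> < d" "\<rho> \<le> R" using d(1) \<open>0 < R\<close> by (auto simp: \<rho>_def)
  have "\<Lambda> powr p * measure \<mu> (ball z \<rho>) < lower_lip f z powr p * measure \<mu> (ball z \<rho>)"
    using lt pos[OF \<rho>(1)] by (rule mult_strict_right_mono)
  also have "\<dots> \<le> measure \<nu> (ball z \<rho>)" using \<rho> by (intro d(2))
  finally show False using assms(2) \<rho> by (auto simp: excess_set_def)
qed

text \<open>
  Two doublings come from the weak type estimate and one from passing to the ball of radius \<open>2 * R\<close>;
the fourth one makes the inequality strict.
\<close>
lemma excess_set_small:
  assumes "0 < \<kappa>" "0 < R" "2 * R < r\<^sub>0"
    and "measure \<nu> (ball u (2 * R)) \<le> \<kappa> powr p * measure \<mu> (ball u (2 * R))"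
  shows "measure \<mu> (excess_set \<nu> \<mu> ((M * \<kappa>) powr p) R \<inter> ball u R) < D ^ 4 / M powr p * measure \<mu> (ball u R)"
proof -
  let ?c = "(M * \<kappa>) powr p"
  have c: "0 < ?c" "?c = M powr p * \<kappa> powr p" using assms(1) M by (auto simp: powr_mult)
  have "measure \<mu> (excess_set \<nu> \<mu> ?c R \<inter> ball u R) \<le> D ^ 2 / ?c * measure \<nu> (ball u (2 * R))"
    using \<nu> \<mu> radon doubling D assms c by (intro measure_excess_set_le) auto
  also have "\<dots> \<le> D ^ 2 / ?c * (\<kappa> powr p * measure \<mu> (ball u (2 * R)))"
    using assms(4) c by (intro mult_left_mono) auto
  also have "\<dots> = D ^ 2 / M powr p * measure \<mu> (ball u (2 * R))"
    using c assms(1) by simp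
  also have "\<dots> \<le> D ^ 2 / M powr p * (D * measure \<mu> (ball u R))"
    using doubling assms(2,3) by (intro mult_left_mono) (auto simp: doubling_def)
  also have "\<dots> = D ^ 3 / M powr p * measure \<mu> (ball u R)"
    by (simp add: power2_eq_square power3_eq_cube)
  also have "\<dots> < D ^ 4 / M powr p * measure \<mu> (ball u R)"
  proof -
    have "D ^ 3 < D ^ 4" using D by (intro power_strict_increasing) auto
    then show ?thesis using pos[OF assms(2)] M
      by (intro mult_strict_right_mono divide_strict_right_mono) auto
  qed
  finally show ?thesis .
qed

text \<open>
  After \<open>n\<close> generations of fillings, the remaining gaps are bounded by the Lipschitz constant \<open>L\<close>. The
hypothesis on \<open>\<nu>\<close> concerns one ball around one of the two points. It passes to each gap because one
of its end points lies off the exceptional set, and because \<open>\<delta> \<le> 1 / 2\<close> keeps the ball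
associated with the gap within the scale \<open>C * dist u v\<close> up to which the excess was tested.
\<close>
lemma increment_le_after_fillings:
  assumes "0 < \<kappa>" "u \<noteq> v" "2 * C * dist u v < r\<^sub>0" "ball u (2 * C * dist u v) \<subseteq> \<Omega>"
    and "measure \<nu> (ball u (2 * C * dist u v)) \<le> \<kappa> powr p * measure \<mu> (ball u (2 * C * dist u v))"
  shows "\<bar>f u - f v\<bar> \<le> (C * M * \<kappa> * (\<Sum>i<n. (M * \<delta>) ^ i) + \<delta> ^ n * L) * dist u v"
  using assms
proof (induction n arbitrary: u v \<kappa>)
  case 0
  then show ?case using lipschitz_onD[OF f, of u v] by (simp add: dist_real_def)
next
  case (Suc n)
  define s where "s = dist u v"
  have s: "0 < s" using Suc.prems(2) by (simp add: s_def)
  have L0: "0 \<le> L" using f by (rule lipschitz_on_nonneg)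
  have Cs: "0 < C * s" "s \<le> C * s" using s C by auto
  define \<Lambda> where "\<Lambda> = M * \<kappa>"
  have \<Lambda>: "0 < \<Lambda>" using M Suc.prems(1) by (simp add: \<Lambda>_def)
  define E where "E = excess_set \<nu> \<mu> (\<Lambda> powr p) (C * s)"
  have "E \<in> sets borel" unfolding E_def using \<nu> \<mu> by (intro borel_open open_excess_set) auto
  moreover have "measure \<mu> (E \<inter> ball u (C * s)) < D ^ 4 / M powr p * measure \<mu> (ball u (C * s))"
    unfolding E_def \<Lambda>_def
    using Suc.prems Cs by (intro excess_set_small) (simp_all add: s_def mult.assoc)
  moreover have "connected_pair \<mu> C \<delta> (D ^ 4 / M powr p) u v"
  proof -
    have "s \<le> r\<^sub>0" using Cs Suc.prems(3) by (simp add: s_def mult.assoc)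
    then show ?thesis using conn s unfolding connected_space_def s_def by blast
  qed
  ultimately obtain K \<gamma> where frag: "curve_fragment K \<gamma>" and ends: "connects K \<gamma> u v"
    and len: "fragment_len K \<gamma> \<le> ennreal (C * s)" and gap: "fragment_gap K \<gamma> < ennreal (\<delta> * s)"
    and avoid: "{t\<in>K. \<gamma> t \<in> E} \<subseteq> {Inf K, Sup K}"
    unfolding connected_pair_def s_def by blast
  have K: "compact K" "K \<noteq> {}" using frag by (auto simp: curve_fragment_def)
  have bb: "bdd_below K" "bdd_above K"
    using K by (auto simp: bounded_imp_bdd_above bounded_imp_bdd_below compact_imp_bounded)
  have inK: "Inf K \<in> K" "Sup K \<in> K"
    using K bb by (auto intro: closed_contains_Inf closed_contains_Sup compact_imp_closed)
  have near: "dist u (\<gamma> t) \<le> C * s" if "t \<in> K" for t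
  proof -
    have "ennreal (dist (\<gamma> (Inf K)) (\<gamma> t)) \<le> fragment_len K \<gamma>"
      by (rule dist_le_fragment_len) (use inK that bb in \<open>auto intro: cInf_lower\<close>)
    also note len
    finally show ?thesis using ends Cs by (simp add: connects_def)
  qed
  have in\<Omega>: "\<gamma> t \<in> \<Omega>" if "t \<in> K" for t
  proof -
    have "dist u (\<gamma> t) < 2 * C * s" using near[OF that] Cs by simp
    then show ?thesis using Suc.prems(4) by (auto simp: s_def)
  qed
  define S where "S = C * M * \<Lambda> * (\<Sum>i<n. (M * \<delta>) ^ i) + \<delta> ^ n * L"
  have S: "0 \<le> S" unfolding S_def
    using C M \<Lambda> \<delta>(1) L0 by (intro add_nonneg_nonneg mult_nonneg_nonneg sum_nonneg zero_le_power) auto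
  have fill: "\<bar>f (\<gamma> t) - f w\<bar> \<le> S * dist (\<gamma> t) w"
    if t: "t \<in> K" "t \<noteq> Inf K" "t \<noteq> Sup K" and w: "dist (\<gamma> t) w < \<delta> * s" for t w
  proof (cases "\<gamma> t = w")
    case False
    let ?r = "dist (\<gamma> t) w"
    have rs: "0 < 2 * C * ?r" "2 * C * ?r \<le> C * s"
    proof -
      have "\<delta> * s \<le> 1 / 2 * s" using \<delta>(2) s by (intro mult_right_mono) auto
      then have "2 * ?r \<le> s" using w by simp
      then show "2 * C * ?r \<le> C * s" using C by (simp add: mult.assoc mult.left_commute[of 2])
    qed (use False C in simp)
    have notE: "\<gamma> t \<notin> E" using avoid t by auto
    have "ball (\<gamma> t) (2 * C * ?r) \<subseteq> ball u (2 * C * s)"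
    proof
      fix y assume "y \<in> ball (\<gamma> t) (2 * C * ?r)"
      then show "y \<in> ball u (2 * C * s)"
        using near[OF t(1)] rs dist_triangle[of u y "\<gamma> t"] by simp
    qed
    then have "ball (\<gamma> t) (2 * C * ?r) \<subseteq> \<Omega>" using Suc.prems(4) by (simp add: s_def)
    moreover have "measure \<nu> (ball (\<gamma> t) (2 * C * ?r)) \<le> \<Lambda> powr p * measure \<mu> (ball (\<gamma> t) (2 * C * ?r))"
      using notE rs unfolding E_def excess_set_def by (auto simp: not_less)
    moreover have "2 * C * ?r < r\<^sub>0"
      using rs Cs Suc.prems(3) by (simp add: s_def)
    ultimately show ?thesis
      unfolding S_def using Suc.IH[OF \<Lambda> False] by simp
  qed simp
  have jumps: "\<bar>f (\<gamma> b) - f (\<gamma> a)\<bar> \<le> S * dist (\<gamma> a) (\<gamma> b)" if ab: "(a, b) \<in> gap_intervals K" for a b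
  proof -
    note e = gap_interval_endpoints[OF K ab]
    have "ennreal (dist (\<gamma> a) (\<gamma> b)) < ennreal (\<delta> * s)"
      using dist_le_fragment_gap[OF ab e(3)] gap by (rule le_less_trans)
    then have small: "dist (\<gamma> a) (\<gamma> b) < \<delta> * s" by (simp add: ennreal_less_iff)
    have aS: "a \<noteq> Sup K" using e cSup_upper[OF e(2) bb(2)] by simp
    have bI: "b \<noteq> Inf K" using e cInf_lower[OF e(1) bb(1)] by simp
    show ?thesis
    \<comment> \<open>The start of the fragment may lie in the exceptional set, and so may its end. A gap from one to
       the other would be too large, so one end point of the gap is an inner point of \<open>K\<close>.\<close>
    proof (cases "a = Inf K")
      case False
      then show ?thesis using fill[OF e(1) False aS small] by (simp add: abs_minus_commute)
    next
      case True
      have "b \<noteq> Sup K"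
      proof
        assume "b = Sup K"
        then have "s < \<delta> * s" using small True ends by (simp add: connects_def s_def)
        moreover have "\<delta> * s \<le> 1 * s" using \<delta>(2) s by (intro mult_right_mono) auto
        ultimately show False by simp
      qed
      then show ?thesis using fill[OF e(2) bI, of "\<gamma> a"] small by (simp add: dist_commute)
    qed
  qed
  have "\<bar>f (\<gamma> (Sup K)) - f (\<gamma> (Inf K))\<bar> \<le> \<Lambda> * (C * s) + S * (\<delta> * s)"
  proof (rule lipschitz_increment_along_fragment[OF frag f len])
    show "fragment_gap K \<gamma> \<le> ennreal (\<delta> * s)" using gap by simp
    show "lower_lip f (\<gamma> t) \<le> \<Lambda>" if "t \<in> K" "Inf K < t" "t < Sup K" for t
      using avoid that in\<Omega> Cs \<Lambda> by (intro lower_lip_le_off_excess_set[of _ _ "C * s"]) (auto simp: E_def)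
  qed (use Cs \<delta> s jumps \<Lambda> S in auto)
  also have "\<dots> = (C * M * \<kappa> * (1 + M * \<delta> * (\<Sum>i<n. (M * \<delta>) ^ i)) + \<delta> ^ Suc n * L) * s"
    by (simp add: S_def \<Lambda>_def algebra_simps)
  also have "1 + M * \<delta> * (\<Sum>i<n. (M * \<delta>) ^ i) = (\<Sum>i<Suc n. (M * \<delta>) ^ i)"
    unfolding sum.lessThan_Suc_shift by (simp add: sum_distrib_left)
  finally show ?case using ends by (simp add: connects_def s_def abs_minus_commute)
qed

lemma increment_le_if_no_excess:
  assumes "0 < \<kappa>" "2 * C * dist u v < r\<^sub>0" "ball u (2 * C * dist u v) \<subseteq> \<Omega>"
    and "measure \<nu> (ball u (2 * C * dist u v)) \<le> \<kappa> powr p * measure \<mu> (ball u (2 * C * dist u v))"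
  shows "\<bar>f u - f v\<bar> \<le> C * M / (1 - M * \<delta>) * \<kappa> * dist u v"
proof (cases "u = v")
  case False
  let ?q = "M * \<delta>"
  have q: "0 \<le> ?q" "?q < 1" using M \<delta> by auto
  have "(\<lambda>n. (C * M * \<kappa> * (\<Sum>i<n. ?q ^ i) + \<delta> ^ n * L) * dist u v)
      \<longlonglongrightarrow> (C * M * \<kappa> * (1 / (1 - ?q)) + 0 * L) * dist u v"
    using geometric_sums[of ?q] q \<delta> unfolding sums_def
    by (intro tendsto_intros LIMSEQ_realpow_zero) auto
  then have "\<bar>f u - f v\<bar> \<le> (C * M * \<kappa> * (1 / (1 - ?q)) + 0 * L) * dist u v"
    by (rule LIMSEQ_le_const) (use increment_le_after_fillings[OF assms(1) False assms(2-4)] in blast)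
  then show ?thesis by (simp add: algebra_simps)
qed simp
end

section \<open>Consequences of connectivity\<close>

lemma metric_measure_space_balls:
  assumes "metric_measure_space \<mu>"
  shows "finite_on_balls \<mu>" "radon_measure \<mu>" "\<And>x r. 0 < r \<Longrightarrow> 0 < measure \<mu> (ball x r)"
proof -
  show radon: "radon_measure \<mu>" using assms by (simp add: metric_measure_space_def)
  have "emeasure \<mu> (ball x r) < \<infinity>" for x r
    using assms by (cases "0 < r") (auto simp: metric_measure_space_def not_less ball_empty)
  then show "finite_on_balls \<mu>"
    using radon by (simp add: finite_on_balls_def radon_measure_def)
  show "0 < measure \<mu> (ball x r)" if "0 < r" for x r
    using assms that by (auto simp: metric_measure_space_def measure_def enn2real_positive_iff)
qed

text \<open>
  Removing an annulus around \<open>x\<close> that separates \<open>x\<close> from \<open>y\<close> forces a gap at least as wide as the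
annulus.
\<close>
lemma annulus_width_less:
  assumes conn: "connected_pair \<mu> C \<eta> \<epsilon> x y" and uv: "0 \<le> u" "u < v" "v \<le> dist x y"
    and small: "measure \<mu> ({z. u < dist x z \<and> dist x z < v} \<inter> ball x (C * dist x y))
             < \<epsilon> * measure \<mu> (ball x (C * dist x y))"
  shows "v - u < \<eta> * dist x y"
proof -
  let ?E = "{z. u < dist x z \<and> dist x z < v}"
  have "?E \<in> sets borel"
    by (intro borel_open open_Collect_conj open_Collect_less continuous_intros)
  then obtain K \<gamma> where frag: "curve_fragment K \<gamma>" and ends: "connects K \<gamma> x y"
    and gap: "fragment_gap K \<gamma> < ennreal (\<eta> * dist x y)"
    and avoid: "{t\<in>K. \<gamma> t \<in> ?E} \<subseteq> {Inf K, Sup K}"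
    using conn small unfolding connected_pair_def by meson
  have K: "compact K" "K \<noteq> {}" and cont: "continuous_on K \<gamma>"
    using frag by (auto simp: curve_fragment_def intro: lipschitz_on_continuous_on)
  have outside: "\<not> (u < dist x (\<gamma> t) \<and> dist x (\<gamma> t) < v)" if "t \<in> K" for t
  proof (cases "t = Inf K \<or> t = Sup K")
    case True
    then show ?thesis using ends uv by (auto simp: connects_def)
  next
    case False
    then show ?thesis using avoid that by blast
  qed
  have "continuous_on K (\<lambda>t. dist x (\<gamma> t))" by (intro continuous_intros cont)
  moreover have "dist x (\<gamma> (Inf K)) \<le> u" "v \<le> dist x (\<gamma> (Sup K))"
    using ends uv by (simp_all add: connects_def)
  ultimately obtain a b where ab: "(a, b) \<in> gap_intervals K" "dist x (\<gamma> a) \<le> u" "v \<le> dist x (\<gamma> b)"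
    by (rule jump_across_forbidden_values[where \<phi> = "\<lambda>t. dist x (\<gamma> t)", OF K _ _ _ uv(2) outside])
  have "ennreal (dist (\<gamma> a) (\<gamma> b)) < ennreal (\<eta> * dist x y)"
    using dist_le_fragment_gap[OF ab(1) gap_interval_endpoints(3)[OF K ab(1)]] gap
    by (rule le_less_trans)
  then have "dist (\<gamma> a) (\<gamma> b) < \<eta> * dist x y" by (simp add: ennreal_less_iff)
  moreover have "v - u \<le> dist (\<gamma> a) (\<gamma> b)" using ab dist_triangle[of x "\<gamma> b" "\<gamma> a"] by simp
  ultimately show ?thesis by simp
qed

lemma exists_thin_annulus:
  fixes \<mu> :: "'a::metric_space measure"
  assumes \<mu>: "finite_on_balls \<mu>" and "0 < N"
  shows "\<exists>i<N. measure \<mu> ({z. real i * s < dist x z \<and> dist x z < real (Suc i) * s} \<inter> ball x R)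
              \<le> measure \<mu> (ball x R) / N"
proof (rule ccontr)
  let ?A = "\<lambda>i. {z. real i * s < dist x z \<and> dist x z < real (Suc i) * s} \<inter> ball x R"
  assume "\<not> ?thesis"
  then have "\<And>i. i < N \<Longrightarrow> measure \<mu> (ball x R) / N < measure \<mu> (?A i)" by (auto simp: not_le)
  then have "(\<Sum>i<N. measure \<mu> (ball x R) / N) < (\<Sum>i<N. measure \<mu> (?A i))"
    using \<open>0 < N\<close> by (intro sum_strict_mono) auto
  also have "\<dots> = measure \<mu> (\<Union>i<N. ?A i)"
  proof (rule measure_finite_Union[symmetric])
    have fm: "?A i \<in> fmeasurable \<mu>" for i
      by (rule finite_on_balls_fmeasurable[OF \<mu>, of _ x R])
         (auto intro!: borel_open open_Int open_Collect_conj open_Collect_less continuous_intros)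
    show "?A ` {..<N} \<subseteq> sets \<mu>" using fmeasurableD[OF fm] by blast
    show "emeasure \<mu> (?A i) \<noteq> \<infinity>" for i using fmeasurableD2[OF fm] by simp
    have disj: "?A i \<inter> ?A j = {}" if "i < j" for i j
    proof (cases "0 \<le> s")
      case True
      then have "real (Suc i) * s \<le> real j * s" using that by (intro mult_right_mono) auto
      then show ?thesis by auto
    next
      case False
      then have "real (Suc i) * s < real i * s" by (intro mult_strict_right_mono_neg) auto
      then show ?thesis by auto
    qed
    show "disjoint_family_on ?A {..<N}"
      unfolding disjoint_family_on_def
    proof (intro ballI impI)
      fix i j :: nat assume "i \<noteq> j"
      then consider "i < j" | "j < i" by linarith
      then show "?A i \<inter> ?A j = {}"
      proof cases
        case 1 then show ?thesis by (rule disj)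
      next
        case 2 then show ?thesis by (subst Int_commute) (rule disj)
      qed
    qed
  qed simp
  also have "\<dots> \<le> measure \<mu> (ball x R)"
    by (rule measure_ball_mono[OF \<mu>])
       (auto intro!: borel_open open_UN open_Int open_Collect_conj open_Collect_less continuous_intros)
  finally show False using \<open>0 < N\<close> by simp
qed

text \<open>
  One of \<open>N\<close> annuli of width \<open>d(x,y) / N\<close> fills less than the fraction \<open>2 / N\<close> of the ball. Its
removal forces a gap of relative size \<open>1 / N\<close>, whereas connectivity allows less than
\<open>C\<^sub>2 (2 / N)\<^bsup>\<alpha>\<^esup>\<close>. For \<open>\<alpha> > 1\<close> these are incompatible when \<open>N\<close> is large.
\<close>
lemma no_close_points_if_exponent_gt_1:
  fixes \<mu> :: "'a::polish_space measure" and x y :: 'a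
  assumes mms: "metric_measure_space \<mu>" and "1 < \<alpha>" "1 \<le> C\<^sub>1" "1 \<le> C\<^sub>2"
    and conn: "locally_finely_connected \<mu> \<alpha> r\<^sub>0 C\<^sub>1 C\<^sub>2" and "dist x y \<le> r\<^sub>0"
  shows "x = y"
proof (rule ccontr)
  assume "x \<noteq> y"
  define s where "s = dist x y"
  have s: "0 < s" using \<open>x \<noteq> y\<close> by (simp add: s_def)
  note \<mu> = metric_measure_space_balls[OF mms]
  define Y where "Y = C\<^sub>2 * 2 powr \<alpha>"
  have "0 < Y" using \<open>1 \<le> C\<^sub>2\<close> by (simp add: Y_def)
  obtain N :: nat where N: "max 3 (Y powr (1 / (\<alpha> - 1))) < real N" using reals_Archimedean2 by blast
  then have N3: "3 < N" by simp
  have "Y = (Y powr (1 / (\<alpha> - 1))) powr (\<alpha> - 1)"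
    using \<open>1 < \<alpha>\<close> \<open>0 < Y\<close> by (simp add: powr_powr)
  also have "\<dots> < real N powr (\<alpha> - 1)" using N \<open>1 < \<alpha>\<close> by (intro powr_less_mono2) auto
  finally have big: "Y < real N powr (\<alpha> - 1)" .
  let ?\<tau> = "2 / real N" and ?B = "ball x (C\<^sub>1 * dist x y)"
  define w where "w = s / N"
  have w: "0 < w" "real N * w = s" using s N3 by (simp_all add: w_def)
  obtain i where i: "i < N"
    "measure \<mu> ({z. real i * w < dist x z \<and> dist x z < real (Suc i) * w} \<inter> ?B) \<le> measure \<mu> ?B / N"
    using exists_thin_annulus[OF \<mu>(1), of N w x "C\<^sub>1 * dist x y"] N3 by auto
  have "0 < measure \<mu> ?B" using \<mu>(3) s \<open>1 \<le> C\<^sub>1\<close> by (simp add: s_def)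
  then have "measure \<mu> ?B / N < ?\<tau> * measure \<mu> ?B" using N3 by (simp add: divide_strict_right_mono)
  with i(2) have thin: "measure \<mu> ({z. real i * w < dist x z \<and> dist x z < real (Suc i) * w} \<inter> ?B)
      < ?\<tau> * measure \<mu> ?B" by (rule le_less_trans)
  have pair: "connected_pair \<mu> C\<^sub>1 (C\<^sub>2 * ?\<tau> powr \<alpha>) ?\<tau> x y"
    using conn N3 s \<open>dist x y \<le> r\<^sub>0\<close>
    by (simp add: locally_finely_connected_def connected_space_def s_def)
  have "real (Suc i) * w \<le> real N * w" using i(1) w(1) by (intro mult_right_mono) auto
  then have top: "real (Suc i) * w \<le> dist x y" using w(2) by (simp add: s_def)
  have bot: "0 \<le> real i * w" "real i * w < real (Suc i) * w" using w(1) by auto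
  have "real (Suc i) * w - real i * w < C\<^sub>2 * ?\<tau> powr \<alpha> * dist x y"
    using pair bot top thin by (rule annulus_width_less)
  then have "w < C\<^sub>2 * ?\<tau> powr \<alpha> * s" by (simp add: s_def algebra_simps)
  then have "s * (1 / N) < s * (C\<^sub>2 * ?\<tau> powr \<alpha>)" by (simp add: w_def mult.commute)
  then have "1 / N < C\<^sub>2 * ?\<tau> powr \<alpha>" using s by (simp only: mult_less_cancel_left_pos)
  also have "\<dots> = Y / (real N powr (\<alpha> - 1) * N)"
    using N3 by (simp add: Y_def powr_divide powr_diff)
  finally have "real N powr (\<alpha> - 1) < Y" using N3 by (simp add: field_simps)
  then show False using big by simp
qed

text \<open>
  If \<open>D = 1\<close>, then \<open>B(x, d/2)\<close> and \<open>B(x, 2d)\<close> have the same measure for \<open>d = d(x,y)\<close>, but the larger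
ball also contains \<open>B(y, d/2)\<close>, which is disjoint from the smaller one.
\<close>
lemma doubling_constant_gt_1:
  fixes \<mu> :: "'a::metric_space measure" and x y :: 'a
  assumes \<mu>: "finite_on_balls \<mu>" "\<And>x r. 0 < r \<Longrightarrow> 0 < measure \<mu> (ball x r)"
    and db: "doubling \<mu> D r\<^sub>0" and "1 \<le> D" and "x \<noteq> y" "dist x y < r\<^sub>0"
  shows "1 < D"
proof (rule ccontr)
  assume "\<not> ?thesis"
  then have D: "D = 1" using \<open>1 \<le> D\<close> by simp
  define d where "d = dist x y"
  have d: "0 < d" "d < r\<^sub>0" using assms by (auto simp: d_def)
  have "measure \<mu> (ball x (2 * d)) \<le> measure \<mu> (ball x d)"
    using db d D by (auto simp: doubling_def)
  also have "\<dots> \<le> measure \<mu> (ball x (d / 2))"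
    using db[unfolded doubling_def, rule_format, of "d / 2" x] d D by simp
  finally have le: "measure \<mu> (ball x (2 * d)) \<le> measure \<mu> (ball x (d / 2))" .
  have fm: "ball z s \<in> fmeasurable \<mu>" for z s
    by (rule finite_on_balls_fmeasurable[OF \<mu>(1), of _ z s]) auto
  have disj: "ball x (d / 2) \<inter> ball y (d / 2) = {}"
    using disjoint_ballI[of "d / 2" "d / 2" x y] by (simp add: d_def)
  have "measure \<mu> (ball x (d / 2)) + measure \<mu> (ball y (d / 2)) = measure \<mu> (ball x (d / 2) \<union> ball y (d / 2))"
    using fm disj fmeasurableD2[OF fm] by (intro measure_Union[symmetric]) (auto intro: fmeasurableD)
  also have "\<dots> \<le> measure \<mu> (ball x (2 * d))"
  proof (rule measure_ball_mono[OF \<mu>(1)])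
    show "ball x (d / 2) \<union> ball y (d / 2) \<subseteq> ball x (2 * d)"
    proof
      fix z assume "z \<in> ball x (d / 2) \<union> ball y (d / 2)"
      then have "dist x z < d / 2 \<or> dist y z < d / 2" by auto
      moreover have "dist x z \<le> d + dist y z" using dist_triangle[of x z y] by (simp add: d_def)
      ultimately have "dist x z < 2 * d" using d(1) by linarith
      then show "z \<in> ball x (2 * d)" by simp
    qed
  qed auto
  finally show False using le \<mu>(2)[of "d / 2" y] d by simp
qed

text \<open>
  An empty annulus has measure zero, so connectivity at every level \<open>\<tau>\<close> applies to it, and the gaps
it allows tend to zero with \<open>\<tau>\<close>.
\<close>
lemma annulus_nonempty:
  fixes \<mu> :: "'a::polish_space measure" and x y :: 'a
  assumes mms: "metric_measure_space \<mu>" and \<alpha>: "0 < \<alpha>" and C: "1 \<le> C\<^sub>1" "1 \<le> C\<^sub>2"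
    and conn: "locally_finely_connected \<mu> \<alpha> r\<^sub>0 C\<^sub>1 C\<^sub>2"
    and uv: "0 \<le> u" "u < v" "v \<le> dist x y" and xy: "dist x y \<le> r\<^sub>0"
  obtains z where "u < dist x z" "dist x z < v"
proof (rule ccontr)
  assume "\<not> thesis"
  then have empty: "{z. u < dist x z \<and> dist x z < v} = {}" using that by auto
  let ?d = "dist x y"
  define \<beta> where "\<beta> = (v - u) / (C\<^sub>2 * ?d)"
  have d: "0 < ?d" using uv by linarith
  have \<beta>: "0 < \<beta>" using uv d C by (simp add: \<beta>_def)
  define \<tau> where "\<tau> = min (1 / 2) (\<beta> powr (1 / \<alpha>))"
  have \<tau>: "0 < \<tau>" "\<tau> < 1" using \<beta> by (auto simp: \<tau>_def)
  have "\<tau> powr \<alpha> \<le> (\<beta> powr (1 / \<alpha>)) powr \<alpha>"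
    using \<tau> \<alpha> by (intro powr_mono2) (auto simp: \<tau>_def)
  also have "\<dots> = \<beta>" using \<alpha> \<beta> by (simp add: powr_powr)
  finally have "\<tau> powr \<alpha> \<le> \<beta>" .
  then have "C\<^sub>2 * \<tau> powr \<alpha> * ?d \<le> C\<^sub>2 * \<beta> * ?d"
    using C d by (intro mult_right_mono mult_left_mono) auto
  also have "\<dots> = v - u" using C d by (simp add: \<beta>_def)
  finally have le: "C\<^sub>2 * \<tau> powr \<alpha> * ?d \<le> v - u" .
  have "connected_pair \<mu> C\<^sub>1 (C\<^sub>2 * \<tau> powr \<alpha>) \<tau> x y"
    using conn \<tau> d xy unfolding locally_finely_connected_def connected_space_def by blast
  moreover have "measure \<mu> ({z. u < dist x z \<and> dist x z < v} \<inter> ball x (C\<^sub>1 * ?d)) < \<tau> * measure \<mu> (ball x (C\<^sub>1 * ?d))"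
    unfolding empty using \<tau> metric_measure_space_balls(3)[OF mms] C d by simp
  ultimately have "v - u < C\<^sub>2 * \<tau> powr \<alpha> * ?d" using uv by (intro annulus_width_less)
  then show False using le by simp
qed

section \<open>Oscillation on balls\<close>

text \<open>
  Since \<open>M\<close> to the power \<open>p \<alpha> - 1\<close> equals \<open>2\<close> to that power times \<open>C\<^sub>2 D\<^sup>4\<close>, the product
\<open>M \<delta>\<close> is at most \<open>2\<close> to the power \<open>1 - p \<alpha>\<close>. This uses \<open>\<alpha> \<le> 1\<close>, to bound
\<open>(D\<^sup>4)\<^bsup>\<alpha>\<^esup>\<close> by \<open>D\<^sup>4\<close>.
\<close>
lemma poincare_constants:
  fixes C\<^sub>2 D p \<alpha> :: real
  assumes "1 \<le> C\<^sub>2" "1 \<le> D" "0 < \<alpha>" "\<alpha> \<le> 1" "1 / \<alpha> < p"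
  defines "M \<equiv> 2 * (C\<^sub>2 * D ^ 4) powr (1 / (p * \<alpha> - 1))"
  defines "\<delta> \<equiv> C\<^sub>2 * (D ^ 4 / M powr p) powr \<alpha>"
  shows "1 < p" "0 < M" "0 \<le> \<delta>" "\<delta> \<le> 1 / 2" "M * \<delta> < 1" "0 < D ^ 4 / M powr p" "D ^ 4 / M powr p < 1"
proof -
  define e where "e = p * \<alpha> - 1"
  have e: "0 < e" using assms(3,5) by (simp add: e_def field_simps)
  have "1 \<le> 1 / \<alpha>" using assms(3,4) by simp
  then show p: "1 < p" using assms(5) by simp
  define Q where "Q = C\<^sub>2 * D ^ 4"
  have D4: "1 \<le> D ^ 4" using assms(2) by (rule one_le_power)
  have Q: "1 \<le> Q" "D ^ 4 \<le> Q"
    unfolding Q_def using mult_mono[of 1 C\<^sub>2 1 "D ^ 4"] mult_right_mono[of 1 C\<^sub>2 "D ^ 4"] assms(1) D4 by auto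
  have "1 \<le> Q powr (1 / e)" using Q(1) e by (intro ge_one_powr_ge_zero) auto
  then have M2: "2 \<le> M" by (simp add: M_def Q_def e_def)
  then show M0: "0 < M" by simp
  have Me: "M powr e = 2 powr e * Q"
    using Q(1) e by (simp add: M_def powr_mult powr_powr flip: Q_def e_def)
  have e1: "1 < 2 powr e" using e by simp
  have pe: "p * \<alpha> = 1 + e" by (simp add: e_def)
  have Mp\<alpha>: "(M powr p) powr \<alpha> = M * M powr e"
    using M0 by (simp add: powr_powr pe powr_add)
  have "M * \<delta> = C\<^sub>2 * (D ^ 4) powr \<alpha> / (2 powr e * Q)"
    unfolding \<delta>_def using assms(2) M0 by (simp add: powr_divide Mp\<alpha> Me)
  also have "\<dots> \<le> C\<^sub>2 * D ^ 4 / (2 powr e * Q)"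
  proof (intro divide_right_mono mult_left_mono)
    have "(D ^ 4) powr \<alpha> \<le> (D ^ 4) powr 1" using D4 assms(4) by (intro powr_mono) auto
    then show "(D ^ 4) powr \<alpha> \<le> D ^ 4" using D4 by simp
  qed (use assms(1) Q in auto)
  also have "\<dots> = 1 / 2 powr e" unfolding Q_def[symmetric] using Q(1) by simp
  also have "\<dots> < 1" using e1 by simp
  finally show M\<delta>: "M * \<delta> < 1" .
  show \<delta>0: "0 \<le> \<delta>" using assms(1) by (simp add: \<delta>_def)
  have "2 * \<delta> \<le> M * \<delta>" using M2 \<delta>0 by (rule mult_right_mono)
  then show "\<delta> \<le> 1 / 2" using M\<delta> by simp
  show "0 < D ^ 4 / M powr p" using M0 assms(2) by (intro divide_pos_pos zero_less_power) auto
  have "D ^ 4 < 2 * (1 * Q)" using Q by simp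
  also have "\<dots> \<le> M * (2 powr e * Q)" using M2 e1 Q(1) by (intro mult_mono) auto
  also have "\<dots> = M powr (p * \<alpha>)" using M0 by (simp add: pe powr_add Me)
  also have "\<dots> \<le> M powr p"
    using M2 p assms(4) by (intro powr_mono) (simp_all add: mult_left_le)
  finally show "D ^ 4 / M powr p < 1" using M0 by simp
qed

lemma average_between:
  assumes \<mu>: "finite_on_balls \<mu>" "0 < measure \<mu> (ball x r)"
    and g: "g \<in> borel_measurable borel" "\<And>z. z \<in> ball x r \<Longrightarrow> a \<le> g z" "\<And>z. z \<in> ball x r \<Longrightarrow> g z \<le> b"
  shows "a \<le> average \<mu> (ball x r) g" "average \<mu> (ball x r) g \<le> b"
proof -
  let ?B = "ball x r"
  have sets: "sets \<mu> = sets borel" and fin: "emeasure \<mu> ?B < \<infinity>"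
    using \<mu>(1) by (auto simp: finite_on_balls_def)
  have B: "?B \<in> sets \<mu>" by (simp add: sets)
  have ig: "set_integrable \<mu> ?B g" unfolding set_integrable_def
  proof (rule integrableI_bounded_set_indicator[OF B _ fin])
    show "g \<in> borel_measurable \<mu>" using g(1) by (simp add: measurable_cong_sets[OF sets refl])
    show "AE z in \<mu>. z \<in> ?B \<longrightarrow> norm (g z) \<le> max \<bar>a\<bar> \<bar>b\<bar>"
      using g(2,3) by (intro AE_I2 impI) force
  qed
  have ic: "set_integrable \<mu> ?B (\<lambda>_. c::real)" for c unfolding set_integrable_def
    by (rule integrableI_bounded_set_indicator[OF B _ fin, of _ "\<bar>c\<bar>"]) auto
  have c: "(LINT z:?B|\<mu>. c) = c * measure \<mu> ?B" for c :: real
    using B fin by (simp add: set_lebesgue_integral_def)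
  have "(LINT z:?B|\<mu>. a) \<le> (LINT z:?B|\<mu>. g z)" using ic ig g(2) by (rule set_integral_mono)
  then show "a \<le> average \<mu> ?B g" using \<mu>(2) c by (simp add: average_def field_simps)
  have "(LINT z:?B|\<mu>. g z) \<le> (LINT z:?B|\<mu>. b)" using ig ic g(3) by (rule set_integral_mono)
  then show "average \<mu> ?B g \<le> b" using \<mu>(2) c by (simp add: average_def field_simps)
qed

lemma average_deviation_le:
  assumes \<mu>: "finite_on_balls \<mu>" "0 < measure \<mu> (ball x r)"
    and f: "f \<in> borel_measurable borel" "\<And>z. z \<in> ball x r \<Longrightarrow> \<bar>f z - c\<bar> \<le> K"
  shows "average \<mu> (ball x r) (\<lambda>z. \<bar>f z - average \<mu> (ball x r) f\<bar>) \<le> 2 * K"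
proof (rule average_between(2)[OF \<mu>, where a = 0])
  have b: "c - K \<le> f z" "f z \<le> c + K" if "z \<in> ball x r" for z using f(2)[OF that] by linarith+
  note av = average_between[OF \<mu> f(1), OF b]
  show "\<bar>f z - average \<mu> (ball x r) f\<bar> \<le> 2 * K" if "z \<in> ball x r" for z
    using av b[OF that] by linarith
qed (use f(1) in auto)

text \<open>
  Two points of the ball at distance \<open>d \<ge> r / 8\<close> fall under the pointwise estimate with
\<open>\<kappa>\<^sup>p\<close> equal to \<open>D\<^sup>6\<close> times the average over the large ball: six doublings of the radius
\<open>C r / 4 \<le> 2 C d\<close> give \<open>16 C r\<close>, enough to cover \<open>B(x\<^sub>0, 8 C r)\<close>. Every point \<open>x\<close> of the
ball is at distance at least \<open>r / 8\<close> from \<open>x\<^sub>0\<close> or from \<open>z\<close>, so \<open>x\<close> and \<open>x\<^sub>0\<close> are joined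
by at most two such steps, of total length at most \<open>3 r\<close>.
\<close>
lemma oscillation_le:
  fixes \<mu> :: "'a::polish_space measure" and f :: "'a \<Rightarrow> real"
  assumes mms: "metric_measure_space \<mu>" and doubling: "doubling \<mu> D r\<^sub>0" and D: "1 < D"
    and C: "1 \<le> C" and M: "0 < M" and p: "1 \<le> p"
    and \<delta>: "0 \<le> \<delta>" "\<delta> \<le> 1 / 2" "M * \<delta> < 1"
    and conn: "connected_space \<mu> C \<delta> (D ^ 4 / M powr p) r\<^sub>0"
    and f: "L-lipschitz_on UNIV f"
    and r: "0 < r" "16 * C * r < r\<^sub>0"
    and z: "z \<in> ball x\<^sub>0 r" "r / 4 \<le> dist x\<^sub>0 z" and x: "x \<in> ball x\<^sub>0 r"
  shows "\<bar>f x - f x\<^sub>0\<bar> \<le> 3 * r * (C * M / (1 - M * \<delta>)) * D ^ 6 *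
    average \<mu> (ball x\<^sub>0 (8 * C * r)) (\<lambda>y. lower_lip f y powr p) powr (1 / p)"
proof -
  note \<mu> = metric_measure_space_balls[OF mms]
  let ?\<Omega> = "ball x\<^sub>0 (8 * C * r)" and ?h = "\<lambda>y. lower_lip f y powr p"
  let ?A = "C * M / (1 - M * \<delta>)"
  define m where "m = average \<mu> ?\<Omega> ?h"
  have Cr: "r \<le> C * r" "0 < C * r" using r C by auto
  have A: "0 \<le> ?A" using C M \<delta> by simp
  have L: "0 \<le> L" using f by (rule lipschitz_on_nonneg)
  have pos: "0 < measure \<mu> ?\<Omega>" using \<mu>(3) Cr by simp
  have fin: "emeasure \<mu> ?\<Omega> < \<infinity>" using \<mu>(1) by (simp add: finite_on_balls_def)
  have h_meas: "?h \<in> borel_measurable borel"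
    using borel_measurable_lower_lip[OF f] by measurable
  have h_le: "?h y \<le> L powr p" for y
    using lower_lip_ereal(2,3)[OF f, of y] p by (intro powr_mono2) auto
  have m0: "0 \<le> m" unfolding m_def
    by (rule average_between(1)[OF \<mu>(1) pos h_meas _ h_le]) simp
  \<comment> \<open>The majorant \<open>\<nu>\<close> raises the average by \<open>\<epsilon>\<close>, which tends to zero at the end.\<close>
  have approx: "\<bar>f x - f x\<^sub>0\<bar> \<le> 3 * r * ?A * D ^ 6 * (m + \<epsilon>) powr (1 / p)" if "0 < \<epsilon>" for \<epsilon>
  proof -
    have "0 < \<epsilon> * measure \<mu> ?\<Omega>" using that pos by simp
    then obtain \<nu> where \<nu>: "finite_on_balls \<nu>"
      "measure \<nu> ?\<Omega> \<le> (LINT y:?\<Omega>|\<mu>. ?h y) + \<epsilon> * measure \<mu> ?\<Omega>"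
      "\<And>y. y \<in> ?\<Omega> \<Longrightarrow> \<exists>d>0. \<forall>\<rho>. 0 < \<rho> \<and> \<rho> < d \<longrightarrow> ?h y * measure \<mu> (ball y \<rho>) \<le> measure \<nu> (ball y \<rho>)"
      using lower_semicontinuous_majorant_measure[OF \<mu>(2,1) _ fin h_meas _ h_le, of "\<epsilon> * measure \<mu> ?\<Omega>"]
      by auto
    have \<nu>\<Omega>: "measure \<nu> ?\<Omega> \<le> (m + \<epsilon>) * measure \<mu> ?\<Omega>"
    proof -
      have "m * measure \<mu> ?\<Omega> = (LINT y:?\<Omega>|\<mu>. ?h y)" using pos by (simp add: m_def average_def)
      then show ?thesis using \<nu>(2) by (simp only: distrib_right)
    qed
    interpret gf: gap_filling \<mu> \<nu> f ?\<Omega> D r\<^sub>0 C M p \<delta> L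
      using \<mu> \<nu>(1,3) doubling D C M p \<delta> conn f by unfold_locales auto
    define \<kappa> where "\<kappa> = (D ^ 6 * (m + \<epsilon>)) powr (1 / p)"
    have D6: "1 \<le> D ^ 6" using D by (intro one_le_power) simp
    have me: "0 < m + \<epsilon>" using m0 that by simp
    have \<kappa>: "0 < \<kappa>" "\<kappa> powr p = D ^ 6 * (m + \<epsilon>)"
      using D6 me p by (auto simp: \<kappa>_def powr_powr)
    have \<kappa>_le: "\<kappa> \<le> D ^ 6 * (m + \<epsilon>) powr (1 / p)"
    proof -
      have "(D ^ 6) powr (1 / p) \<le> (D ^ 6) powr 1" using D6 p by (intro powr_mono) auto
      then have "(D ^ 6) powr (1 / p) \<le> D ^ 6" using D6 by simp
      then have "(D ^ 6) powr (1 / p) * (m + \<epsilon>) powr (1 / p) \<le> D ^ 6 * (m + \<epsilon>) powr (1 / p)"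
        by (rule mult_right_mono) simp
      then show ?thesis using D6 me by (simp add: \<kappa>_def powr_mult)
    qed
    have far: "\<bar>f u - f v\<bar> \<le> ?A * \<kappa> * dist u v"
      if u: "u \<in> ball x\<^sub>0 r" and uv: "r / 8 \<le> dist u v" "dist u v < 2 * r" for u v
    proof (rule gf.increment_le_if_no_excess[OF \<kappa>(1)])
      have "C * dist u v \<le> C * (2 * r)" using uv C by (intro mult_left_mono) auto
      then have up: "2 * C * dist u v \<le> 4 * C * r" by simp
      then show "2 * C * dist u v < r\<^sub>0" using r(2) Cr(2) by linarith
      show sub: "ball u (2 * C * dist u v) \<subseteq> ?\<Omega>"
      proof
        fix y assume "y \<in> ball u (2 * C * dist u v)"
        then have "dist u y < 4 * C * r" using up by simp
        moreover have "dist x\<^sub>0 u < r" using u by simp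
        moreover note dist_triangle[of x\<^sub>0 y u]
        ultimately have "dist x\<^sub>0 y < 8 * C * r" using Cr by linarith
        then show "y \<in> ?\<Omega>" by simp
      qed
      have "C * (r / 8) \<le> C * dist u v" using uv C by (intro mult_left_mono) auto
      then have low: "C * r / 4 \<le> 2 * C * dist u v" by simp
      have "measure \<mu> ?\<Omega> \<le> measure \<mu> (ball u (2 ^ 6 * (C * r / 4)))"
      proof (rule measure_ball_mono[OF \<mu>(1)])
        show "?\<Omega> \<subseteq> ball u (2 ^ 6 * (C * r / 4))"
        proof
          fix y assume "y \<in> ?\<Omega>"
          then have "dist x\<^sub>0 y < 8 * C * r" by simp
          moreover have "dist u x\<^sub>0 < r" using u by (simp add: dist_commute)
          moreover note dist_triangle[of u y x\<^sub>0]
          ultimately have "dist u y < 16 * (C * r)" using Cr by linarith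
          then show "y \<in> ball u (2 ^ 6 * (C * r / 4))" by simp
        qed
      qed simp
      also have "\<dots> \<le> D ^ 6 * measure \<mu> (ball u (C * r / 4))"
        using doubling D Cr r by (intro doubling_iterate) auto
      also have "\<dots> \<le> D ^ 6 * measure \<mu> (ball u (2 * C * dist u v))"
        using low D by (intro mult_left_mono measure_ball_mono[OF \<mu>(1)] subset_ball) auto
      finally have comp: "measure \<mu> ?\<Omega> \<le> D ^ 6 * measure \<mu> (ball u (2 * C * dist u v))" .
      have "measure \<nu> (ball u (2 * C * dist u v)) \<le> measure \<nu> ?\<Omega>"
        using sub by (intro measure_ball_mono[OF \<nu>(1)]) auto
      also note \<nu>\<Omega>
      also have "(m + \<epsilon>) * measure \<mu> ?\<Omega> \<le> (m + \<epsilon>) * (D ^ 6 * measure \<mu> (ball u (2 * C * dist u v)))"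
        using comp me by (intro mult_left_mono) auto
      finally show "measure \<nu> (ball u (2 * C * dist u v)) \<le> \<kappa> powr p * measure \<mu> (ball u (2 * C * dist u v))"
        by (simp add: \<kappa>(2) mult_ac)
    qed
    have far': "\<bar>f u - f v\<bar> \<le> ?A * \<kappa> * t"
      if "u \<in> ball x\<^sub>0 r" "r / 8 \<le> dist u v" "dist u v \<le> t" "dist u v < 2 * r" for u v t
    proof -
      have "?A * \<kappa> * dist u v \<le> ?A * \<kappa> * t"
        using that A \<kappa>(1) by (intro mult_left_mono mult_nonneg_nonneg) auto
      then show ?thesis using far[OF that(1,2,4)] by linarith
    qed
    have x0: "x\<^sub>0 \<in> ball x\<^sub>0 r" using r by simp
    have "\<bar>f x - f x\<^sub>0\<bar> \<le> ?A * \<kappa> * (3 * r)"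
    proof (cases "r / 8 \<le> dist x x\<^sub>0")
      case True
      then show ?thesis using x r by (intro far') (auto simp: dist_commute)
    next
      case False
      then have "r / 8 \<le> dist x z" "dist x z < 2 * r"
        using z dist_triangle[of x\<^sub>0 z x] dist_triangle[of x z x\<^sub>0] r by (auto simp: dist_commute)
      then have "\<bar>f x - f z\<bar> \<le> ?A * \<kappa> * (2 * r)" by (intro far' x) auto
      moreover have "\<bar>f z - f x\<^sub>0\<bar> \<le> ?A * \<kappa> * r"
        using z r by (intro far') (auto simp: dist_commute)
      ultimately have "\<bar>f x - f x\<^sub>0\<bar> \<le> ?A * \<kappa> * (2 * r) + ?A * \<kappa> * r" by linarith
      then show ?thesis by (simp add: algebra_simps)
    qed
    also have "\<dots> \<le> ?A * (D ^ 6 * (m + \<epsilon>) powr (1 / p)) * (3 * r)"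
      using A \<kappa>_le r by (intro mult_right_mono mult_left_mono) auto
    finally show ?thesis by (simp add: mult_ac)
  qed
  have "\<bar>f x - f x\<^sub>0\<bar> \<le> 3 * r * ?A * D ^ 6 * (m + 0) powr (1 / p)"
  proof (rule tendsto_lowerbound)
    show "((\<lambda>\<epsilon>. 3 * r * ?A * D ^ 6 * (m + \<epsilon>) powr (1 / p)) \<longlongrightarrow> 3 * r * ?A * D ^ 6 * (m + 0) powr (1 / p))
        (at_right 0)"
    proof (intro tendsto_mult tendsto_const tendsto_powr2 tendsto_add tendsto_ident_at)
      show "\<forall>\<^sub>F \<epsilon> in at_right 0. 0 \<le> m + \<epsilon>"
        using eventually_at_right_less[of "0::real"] by eventually_elim (use m0 in simp)
    qed (use p in simp)
    show "\<forall>\<^sub>F \<epsilon> in at_right 0. \<bar>f x - f x\<^sub>0\<bar> \<le> 3 * r * ?A * D ^ 6 * (m + \<epsilon>) powr (1 / p)"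
      using eventually_at_right_less[of "0::real"] by eventually_elim (rule approx)
  qed simp
  then show ?thesis by (simp add: m_def)
qed

section \<open>The Poincare inequality\<close>

text \<open>
  Here \<open>f\<close> is constant on the balls in question and \<open>lower_lip f\<close> vanishes. The constant is
arbitrary, since the one of the theorem may be negative when \<open>\<alpha> > 1\<close>.
\<close>
lemma local_poincare_if_isolated:
  fixes \<mu> :: "'a::metric_space measure"
  assumes \<mu>: "finite_on_balls \<mu>" "\<And>x r. 0 < r \<Longrightarrow> 0 < measure \<mu> (ball x r)"
    and iso: "\<And>x y :: 'a. dist x y < r\<^sub>0 \<Longrightarrow> x = y" and "0 < p" "1 \<le> C" "r\<^sub>1 * C \<le> r\<^sub>0"
  shows "local_poincare \<mu> p r\<^sub>1 C C_PI"
  unfolding local_poincare_def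
proof (intro allI impI, elim conjE exE)
  fix x :: 'a and r f L assume r: "0 < r" "r < r\<^sub>1" and f: "L-lipschitz_on UNIV (f :: 'a \<Rightarrow> real)"
  have "C * r \<le> C * r\<^sub>1" using r \<open>1 \<le> C\<close> by (intro mult_left_mono) auto
  then have Cr: "C * r \<le> r\<^sub>0" using \<open>r\<^sub>1 * C \<le> r\<^sub>0\<close> by (simp add: mult.commute)
  have rC: "r \<le> C * r" using r \<open>1 \<le> C\<close> by simp
  have small: "z = x" if "z \<in> ball x s" "s \<le> r\<^sub>0" for z s using iso[of x z] that by simp
  have zero: "lower_lip f x = 0" for x
  proof -
    have "lower_lip f x \<le> 0"
      unfolding lower_lip_le_iff[OF f]
    proof (intro allI impI)
      fix \<Lambda> \<epsilon> :: real assume "0 < \<Lambda>" "0 < \<epsilon>"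
      define \<rho> where "\<rho> = min r\<^sub>0 \<epsilon> / 2"
      have "0 < r\<^sub>0" using r Cr rC by linarith
      then have \<rho>: "0 < \<rho>" "\<rho> < \<epsilon>" "\<rho> < r\<^sub>0" using \<open>0 < \<epsilon>\<close> by (auto simp: \<rho>_def)
      have "\<bar>f x - f y\<bar> \<le> \<Lambda> * \<rho>" if "y \<in> ball x \<rho>" for y
        using iso[of x y] that \<rho> \<open>0 < \<Lambda>\<close> by simp
      then show "\<exists>r. 0 < r \<and> r < \<epsilon> \<and> (\<forall>y\<in>ball x r. \<bar>f x - f y\<bar> \<le> \<Lambda> * r)" using \<rho> by blast
    qed
    then show ?thesis using lower_lip_ereal(2)[OF f, of x] by simp
  qed
  have "average \<mu> (ball x r) (\<lambda>z. \<bar>f z - average \<mu> (ball x r) f\<bar>) \<le> 2 * 0"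
  proof (rule average_deviation_le[OF \<mu>(1) \<mu>(2)[OF r(1)]])
    show "f \<in> borel_measurable borel"
      by (intro borel_measurable_continuous_onI lipschitz_on_continuous_on[OF f])
    show "\<bar>f z - f x\<bar> \<le> 0" if "z \<in> ball x r" for z using small[OF that] Cr rC by simp
  qed
  then show "average \<mu> (ball x r) (\<lambda>z. \<bar>f z - average \<mu> (ball x r) f\<bar>)
      \<le> C_PI * r * average \<mu> (ball x (C * r)) (\<lambda>z. lower_lip f z powr p) powr (1 / p)"
    by (simp add: zero average_def)
qed

lemma local_poincare_if_exponent_le_1:
  fixes \<mu> :: "'a::polish_space measure"
  assumes mms: "metric_measure_space \<mu>" and D: "1 < D" and \<alpha>: "0 < \<alpha>" "\<alpha> \<le> 1"
    and C: "1 \<le> C\<^sub>1" "1 \<le> C\<^sub>2" and doubling: "doubling \<mu> D r\<^sub>0"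
    and conn: "locally_finely_connected \<mu> \<alpha> r\<^sub>0 C\<^sub>1 C\<^sub>2" and p: "1 / \<alpha> < p"
  defines "M \<equiv> 2 * (C\<^sub>2 * D ^ 4) powr (1 / (p * \<alpha> - 1))"
  defines "\<delta> \<equiv> C\<^sub>2 * (D ^ 4 / M powr p) powr \<alpha>"
  shows "local_poincare \<mu> p (r\<^sub>0 / (16 * C\<^sub>1)) (8 * C\<^sub>1) (8 * D ^ 6 * (C\<^sub>1 * M / (1 - M * \<delta>)))"
  unfolding local_poincare_def
proof (intro allI impI, elim conjE exE)
  fix x\<^sub>0 :: 'a and r f L assume r: "0 < r" "r < r\<^sub>0 / (16 * C\<^sub>1)" and f: "L-lipschitz_on UNIV (f :: 'a \<Rightarrow> real)"
  have Cr: "16 * C\<^sub>1 * r < r\<^sub>0" "0 < C\<^sub>1 * r" "r \<le> C\<^sub>1 * r" using r C by (simp_all add: field_simps)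
  have D1: "1 \<le> D" using D by simp
  note \<mu> = metric_measure_space_balls[OF mms]
  note const_bounds = poincare_constants[OF C(2) D1 \<alpha> p, folded M_def, folded \<delta>_def]
  have conn1: "connected_space \<mu> C\<^sub>1 \<delta> (D ^ 4 / M powr p) r\<^sub>0"
    using conn const_bounds(6,7) unfolding locally_finely_connected_def \<delta>_def by blast
  let ?B = "ball x\<^sub>0 r" and ?\<Omega> = "ball x\<^sub>0 (8 * C\<^sub>1 * r)"
  define m where "m = average \<mu> ?\<Omega> (\<lambda>z. lower_lip f z powr p) powr (1 / p)"
  define A where "A = C\<^sub>1 * M / (1 - M * \<delta>)"
  have A: "0 \<le> A" using C const_bounds by (simp add: A_def)
  have m: "0 \<le> m" by (simp add: m_def)
  have osc: "\<bar>f x - f x\<^sub>0\<bar> \<le> 3 * r' * A * D ^ 6 * m"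
    if r': "0 < r'" "r' \<le> r" and B: "ball x\<^sub>0 (8 * C\<^sub>1 * r') = ?\<Omega>"
      and z: "z \<in> ball x\<^sub>0 r'" "r' / 4 \<le> dist x\<^sub>0 z" and x: "x \<in> ball x\<^sub>0 r'" for r' z x
  proof -
    have "16 * C\<^sub>1 * r' \<le> 16 * C\<^sub>1 * r" using r' C by (intro mult_left_mono) auto
    then have small: "16 * C\<^sub>1 * r' < r\<^sub>0" using Cr by simp
    show ?thesis
      unfolding A_def m_def B[symmetric]
      using mms doubling D C(1) const_bounds(1,2,3,4,5) conn1 f r'(1) small z x by (intro oscillation_le) auto
  qed
  have bound: "\<bar>f x - f x\<^sub>0\<bar> \<le> 3 * r * A * D ^ 6 * m" if x: "x \<in> ?B" for x
  proof (cases "\<exists>z\<in>?B. r / 4 \<le> dist x\<^sub>0 z")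
    case True
    then show ?thesis using osc[of r] r x by auto
  next
    case False
    then have near: "dist x\<^sub>0 z < r / 4" if "z \<in> ?B" for z using that by (auto simp: not_le)
    have empty: "dist x\<^sub>0 w < r" if "w \<in> ?\<Omega>" for w
    proof (rule ccontr)
      assume "\<not> dist x\<^sub>0 w < r"
      moreover have "dist x\<^sub>0 w \<le> r\<^sub>0" using that Cr by simp
      ultimately obtain z where "r / 4 < dist x\<^sub>0 z" "dist x\<^sub>0 z < r"
        using annulus_nonempty[OF mms \<alpha>(1) C conn, of "r / 4" r x\<^sub>0 w] r by auto
      then show False using near[of z] by simp
    qed
    \<comment> \<open>The large ball lies within distance \<open>r\<close>, hence within distance \<open>\<sigma>\<close>, of \<open>x\<^sub>0\<close>. Replacing \<open>r\<close> by
       \<open>2 * \<sigma>\<close> changes neither ball and restores a point at relative distance \<open>1 / 4\<close>.\<close>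
    define \<sigma> where "\<sigma> = (SUP z\<in>?B. dist x\<^sub>0 z)"
    have bdd: "bdd_above (dist x\<^sub>0 ` ?B)" using near by (auto intro!: bdd_aboveI[of _ "r / 4"] less_imp_le)
    have le\<sigma>: "dist x\<^sub>0 z \<le> \<sigma>" if "z \<in> ?B" for z
      unfolding \<sigma>_def using that bdd by (rule cSUP_upper)
    have \<sigma>_le: "\<sigma> \<le> r / 4"
      unfolding \<sigma>_def using near r by (intro cSUP_least) (auto intro: less_imp_le)
    show ?thesis
    proof (cases "x = x\<^sub>0")
      case True
      then show ?thesis using A m r D by simp
    next
      case False
      then have \<sigma>: "0 < \<sigma>" using le\<sigma>[OF x] by (smt (verit) zero_less_dist_iff)
      have "\<sigma> / 2 < (SUP z\<in>?B. dist x\<^sub>0 z)" using \<sigma> unfolding \<sigma>_def by simp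
      then obtain z where z: "z \<in> ?B" "\<sigma> / 2 < dist x\<^sub>0 z"
        using less_cSUP_iff[OF _ bdd] x by blast
      have "\<bar>f x - f x\<^sub>0\<bar> \<le> 3 * (2 * \<sigma>) * A * D ^ 6 * m"
      proof (rule osc[of _ z])
        show "0 < 2 * \<sigma>" "2 * \<sigma> \<le> r" using \<sigma> \<sigma>_le r by auto
        show "z \<in> ball x\<^sub>0 (2 * \<sigma>)" "x \<in> ball x\<^sub>0 (2 * \<sigma>)" using le\<sigma>[OF z(1)] le\<sigma>[OF x] \<sigma> by auto
        show "2 * \<sigma> / 4 \<le> dist x\<^sub>0 z" using z(2) by simp
        show "ball x\<^sub>0 (8 * C\<^sub>1 * (2 * \<sigma>)) = ?\<Omega>"
        proof
          have "C\<^sub>1 * (2 * \<sigma>) \<le> C\<^sub>1 * r" using \<sigma>_le r C by (intro mult_left_mono) auto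
          then show "ball x\<^sub>0 (8 * C\<^sub>1 * (2 * \<sigma>)) \<subseteq> ?\<Omega>" by (intro subset_ball) simp
          have "1 * (2 * \<sigma>) \<le> C\<^sub>1 * (2 * \<sigma>)" using C \<sigma> by (intro mult_right_mono) auto
          then have big: "\<sigma> < 8 * C\<^sub>1 * (2 * \<sigma>)" using \<sigma> by simp
          show "?\<Omega> \<subseteq> ball x\<^sub>0 (8 * C\<^sub>1 * (2 * \<sigma>))"
          proof
            fix w assume "w \<in> ?\<Omega>"
            then have "w \<in> ?B" using empty by simp
            from le\<sigma>[OF this] big have "dist x\<^sub>0 w < 8 * C\<^sub>1 * (2 * \<sigma>)" by (rule le_less_trans)
            then show "w \<in> ball x\<^sub>0 (8 * C\<^sub>1 * (2 * \<sigma>))" by simp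
          qed
        qed
      qed
      also have "\<dots> \<le> 3 * r * A * D ^ 6 * m"
        using \<sigma>_le r A m D by (intro mult_right_mono) auto
      finally show ?thesis .
    qed
  qed
  have "average \<mu> ?B (\<lambda>z. \<bar>f z - average \<mu> ?B f\<bar>) \<le> 2 * (3 * r * A * D ^ 6 * m)"
  proof (rule average_deviation_le[OF \<mu>(1) \<mu>(3)[OF r(1)] _ bound])
    show "f \<in> borel_measurable borel"
      by (intro borel_measurable_continuous_onI lipschitz_on_continuous_on[OF f])
  qed
  also have "\<dots> \<le> 8 * (r * A * D ^ 6 * m)" using r A m D by simp
  finally show "average \<mu> ?B (\<lambda>z. \<bar>f z - average \<mu> ?B f\<bar>)
      \<le> 8 * D ^ 6 * (C\<^sub>1 * M / (1 - M * \<delta>)) * r * average \<mu> ?\<Omega> (\<lambda>z. lower_lip f z powr p) powr (1 / p)"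
    unfolding A_def m_def by (simp only: mult_ac)
qed

theorem theorem1p9:
  fixes \<mu> :: "'a::polish_space measure" and D r\<^sub>0 \<alpha> C\<^sub>1 C\<^sub>2 :: real
  assumes "metric_measure_space \<mu>"
    and "D \<ge> 1" and "r\<^sub>0 > 0" and "\<alpha> > 0" and "C\<^sub>1 \<ge> 1" and "C\<^sub>2 \<ge> 1"
    and "doubling \<mu> D r\<^sub>0"
    and "locally_finely_connected \<mu> \<alpha> r\<^sub>0 C\<^sub>1 C\<^sub>2"
  shows "(\<forall>p > 1 / \<alpha>.
            let M = 2 * (C\<^sub>2 * D ^ 4) powr (1 / (p * \<alpha> - 1));
                \<delta> = C\<^sub>2 * (D ^ 4 / M powr p) powr \<alpha>;
                C_PI = 8 * D ^ 6 * (C\<^sub>1 * M / (1 - M * \<delta>))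
            in local_poincare \<mu> p (r\<^sub>0 / (16 * C\<^sub>1)) (8 * C\<^sub>1) C_PI)
         \<and> PI_space \<mu>"
proof -
  note \<mu> = metric_measure_space_balls[OF assms(1)]
  let ?r = "r\<^sub>0 / (16 * C\<^sub>1)"
  have r: "0 < ?r" "?r \<le> r\<^sub>0" "?r * (8 * C\<^sub>1) \<le> r\<^sub>0" using assms(3,5) by (auto simp: field_simps)
  have PI: "PI_space \<mu>" if "1 \<le> p" "0 < C_PI" "local_poincare \<mu> p ?r (8 * C\<^sub>1) C_PI" for p C_PI
  proof -
    have "doubling \<mu> D ?r" using assms(7) r(2) by (auto simp: doubling_def)
    moreover have "1 \<le> 8 * C\<^sub>1" using assms(5) by simp
    ultimately show ?thesis
      unfolding PI_space_def using assms(1,2) r(1) that by blast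
  qed
  define p\<^sub>0 where "p\<^sub>0 = 1 / \<alpha> + 1"
  have p0: "1 / \<alpha> < p\<^sub>0" "1 \<le> p\<^sub>0" using assms(4) by (auto simp: p\<^sub>0_def)
  show ?thesis
  proof (cases "\<forall>x y :: 'a. dist x y < r\<^sub>0 \<longrightarrow> x = y")
    case True
    have pc: "local_poincare \<mu> p ?r (8 * C\<^sub>1) C_PI" if "0 < p" for p C_PI
      using True that assms(5) r(3) by (intro local_poincare_if_isolated[OF \<mu>(1,3)]) auto
    have "0 < p" if "1 / \<alpha> < p" for p using that assms(4) by (meson less_trans zero_less_divide_1_iff)
    then have lp: "local_poincare \<mu> p ?r (8 * C\<^sub>1) c" if "1 / \<alpha> < p" for p c using pc that by blast
    have "PI_space \<mu>" by (rule PI[OF p0(2) _ lp[OF p0(1), of 1]]) simp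
    then show ?thesis unfolding Let_def using lp by blast
  next
    case False
    then obtain x y :: 'a where xy: "dist x y < r\<^sub>0" "x \<noteq> y" by blast
    have \<alpha>: "\<alpha> \<le> 1"
      using no_close_points_if_exponent_gt_1[OF assms(1) _ assms(5,6,8), of x y] xy by force
    have D: "1 < D" using doubling_constant_gt_1[OF \<mu>(1,3) assms(7,2) xy(2,1)] .
    note lp = local_poincare_if_exponent_le_1[OF assms(1) D assms(4) \<alpha> assms(5-8)]
    let ?M = "2 * (C\<^sub>2 * D ^ 4) powr (1 / (p\<^sub>0 * \<alpha> - 1))"
    let ?\<delta> = "C\<^sub>2 * (D ^ 4 / ?M powr p\<^sub>0) powr \<alpha>"
    note const_bounds = poincare_constants[OF assms(6,2,4) \<alpha> p0(1)]
    have "0 < 8 * D ^ 6 * (C\<^sub>1 * ?M / (1 - ?M * ?\<delta>))"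
      using const_bounds(2,5) D assms(5) by (intro mult_pos_pos divide_pos_pos zero_less_power) auto
    then have "PI_space \<mu>" using PI[OF p0(2) _ lp[OF p0(1)]] by blast
    then show ?thesis unfolding Let_def using lp by blast
  qed
qed

end
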